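(* Let $T$ be a strictly positive conditional expectation on the $T$-universally complete Riesz space $E$ with weak order unit $e=Te$. Let $\Lambda$ be a totally ordered index set. For $(X_t)_{t\in\Lambda}\subset E$ the following are equivalent: (i) The process $(X_t)_{t\in\Lambda}$ is a Markov process. (ii) For all $u<v$ in $\Lambda$, $$\mathbb{T}_uT_v=T_uT_v,$$ where $\mathbb{T}_u$ and $T_v$ are the conditional expectations with ranges $\mathcal{R}(\mathbb{T}_u)=\langle\mathcal{R}(T),X_n;\ n\le u\rangle$ and $\mathcal{R}(T_v)=\langle\mathcal{R}(T),X_v\rangle$ (and $T_u$ is likewise the conditional expectation with range $\langle\mathcal{R}(T),X_u\rangle$). (iii) For any $s_m>\dots>s_1>t>t_n>\dots>t_1$ from $\Lambda$, and $P,Q$ band projections on $E$ with $Qe\in\langle\mathcal{R}(T),X_{s_1},\dots,X_{s_m}\rangle$ and $Pe\in\langle\mathcal{R}(T),X_{t_1},\dots,X_{t_n}\rangle$, we have $$T_tQT_tPe=T_tQPe=T_tPQe=T_tPT_tQe.$$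
   Context: A conditional expectation on a Riesz space $E$ with weak order unit is a positive order continuous projection $T:E\to E$ whose range $\mathcal{R}(T)$ is a Dedekind complete Riesz subspace of $E$ and such that $T(u)$ is a weak order unit of $E$ for each weak order unit $u$ of $E$. $T$ is strictly positive if $f\ge 0$ and $Tf=0$ imply $f=0$. A Dedekind complete Riesz space $E$ with weak order unit and strictly positive conditional expectation $T$ is $T$-universally complete if every increasing net $(f_\alpha)$ in $E^+$ with $(Tf_\alpha)$ order bounded is order convergent in $E$. $\langle\cdots\rangle$ denotes the closed (under order limits) Riesz subspace of $E$ generated by the listed sets/elements. Known fact: for each closed Riesz subspace $F$ of $E$ with $\mathcal{R}(T)\subset F$ there is a unique conditional expectation $T_F$ on $E$ with $\mathcal{R}(T_F)=F$ and $TT_F=T=T_FT$; the conditional expectation with range $F$ always means this $T_F$. For $t_1,\dots,t_n\in\Lambda$, $T_{(t_1,\dots,t_n)}$ is the conditional expectation with range $\langle\mathcal{R}(T),X_{t_1},\dots,X_{t_n}\rangle$, and $T_t$ is the conditional expectation with range $\langle\mathcal{R}(T),X_t\rangle$. A net $(X_\lambda)_{\lambda\in\Lambda}$ in $E$ is a Markov process if for any $t_1<\dots<t_n<t$ in $\Lambda$, $T_{(t_1,\dots,t_n)}Pe=T_{t_n}Pe$ for all band projections $P$ on $E$ with $Pe\in\langle\mathcal{R}(T),X_t\rangle$. *)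

theory Defs
  imports Complex_Main "HOL-Library.Lattice_Algebras"
begin

class riesz_space = ordered_real_vector + lattice_ab_group_add_abs

class dedekind_complete_riesz_space = riesz_space + conditionally_complete_lattice

section \<open>Order convergence\<close>

text \<open>
  Nets are represented by the filters of their tails. A family of elements of the space
  decreases to zero if it is downward directed and has greatest lower bound zero; order
  convergence is domination of the distance to the limit, eventually, by every member of
  such a family.
\<close>

definition decreases_to_zero :: "'a::riesz_space set \<Rightarrow> bool" where
  "decreases_to_zero D \<longleftrightarrow>
     D \<noteq> {} \<and> (\<forall>a\<in>D. \<forall>b\<in>D. \<exists>c\<in>D. c \<le> a \<and> c \<le> b) \<and>
     (\<forall>d\<in>D. 0 \<le> d) \<and> (\<forall>z. (\<forall>d\<in>D. z \<le> d) \<longrightarrow> z \<le> 0)"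

definition order_conv :: "('i \<Rightarrow> 'a::riesz_space) \<Rightarrow> 'a \<Rightarrow> 'i filter \<Rightarrow> bool" where
  "order_conv f l F \<longleftrightarrow>
     (\<exists>D. decreases_to_zero D \<and> (\<forall>d\<in>D. eventually (\<lambda>i. \<bar>f i - l\<bar> \<le> d) F))"

definition directed_preorder :: "'i set \<Rightarrow> ('i \<Rightarrow> 'i \<Rightarrow> bool) \<Rightarrow> bool" where
  "directed_preorder I r \<longleftrightarrow>
     I \<noteq> {} \<and> (\<forall>i\<in>I. r i i) \<and> (\<forall>i\<in>I. \<forall>j\<in>I. \<forall>k\<in>I. r i j \<longrightarrow> r j k \<longrightarrow> r i k) \<and>
     (\<forall>i\<in>I. \<forall>j\<in>I. \<exists>k\<in>I. r i k \<and> r j k)"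

definition tails :: "'i set \<Rightarrow> ('i \<Rightarrow> 'i \<Rightarrow> bool) \<Rightarrow> 'i filter" where
  "tails I r = (INF i\<in>I. principal {j \<in> I. r i j})"

text \<open>
  Every proper filter on the space is the image of the tail filter of some net in it, and
  conversely, so quantifying over filters on the space itself is quantifying over all nets.
\<close>

definition order_closed :: "'a::riesz_space set \<Rightarrow> bool" where
  "order_closed S \<longleftrightarrow>
     (\<forall>F l. F \<noteq> bot \<longrightarrow> eventually (\<lambda>x. x \<in> S) F \<longrightarrow> order_conv (\<lambda>x. x) l F \<longrightarrow> l \<in> S)"

definition order_continuous :: "('a::riesz_space \<Rightarrow> 'b::riesz_space) \<Rightarrow> bool" where
  "order_continuous T \<longleftrightarrow> (\<forall>F l. order_conv (\<lambda>x. x) l F \<longrightarrow> order_conv T (T l) F)"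

section \<open>Riesz subspaces, bands and weak order units\<close>

definition riesz_subspace :: "'a::riesz_space set \<Rightarrow> bool" where
  "riesz_subspace F \<longleftrightarrow> subspace F \<and> (\<forall>x\<in>F. \<forall>y\<in>F. sup x y \<in> F \<and> inf x y \<in> F)"

text \<open>Completeness of the subspace in its own order: bounds and suprema are taken inside it.\<close>

definition dedekind_complete_subspace :: "'a::riesz_space set \<Rightarrow> bool" where
  "dedekind_complete_subspace F \<longleftrightarrow>
     riesz_subspace F \<and>
     (\<forall>A\<subseteq>F. A \<noteq> {} \<longrightarrow> (\<exists>b\<in>F. \<forall>a\<in>A. a \<le> b) \<longrightarrow>
        (\<exists>s\<in>F. (\<forall>a\<in>A. a \<le> s) \<and> (\<forall>b\<in>F. (\<forall>a\<in>A. a \<le> b) \<longrightarrow> s \<le> b)))"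

definition closed_riesz_span :: "'a::riesz_space set \<Rightarrow> 'a set" where
  "closed_riesz_span S = (\<lambda>F. riesz_subspace F \<and> order_closed F) hull S"

definition band :: "'a::riesz_space set \<Rightarrow> bool" where
  "band B \<longleftrightarrow>
     subspace B \<and> (\<forall>x y. y \<in> B \<longrightarrow> \<bar>x\<bar> \<le> \<bar>y\<bar> \<longrightarrow> x \<in> B) \<and> order_closed B"

definition disjoint_complement :: "'a::riesz_space set \<Rightarrow> 'a set" where
  "disjoint_complement B = {x. \<forall>y\<in>B. inf \<bar>x\<bar> \<bar>y\<bar> = 0}"

definition band_projection :: "('a::riesz_space \<Rightarrow> 'a) \<Rightarrow> bool" where
  "band_projection P \<longleftrightarrow>
     (\<exists>B. band B \<and> (\<forall>x. P x \<in> B \<and> x - P x \<in> disjoint_complement B))"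

definition weak_order_unit :: "'a::riesz_space \<Rightarrow> bool" where
  "weak_order_unit e \<longleftrightarrow> 0 \<le> e \<and> (\<forall>x. inf e \<bar>x\<bar> = 0 \<longrightarrow> x = 0)"

section \<open>Conditional expectations\<close>

definition conditional_expectation :: "('a::riesz_space \<Rightarrow> 'a) \<Rightarrow> bool" where
  "conditional_expectation T \<longleftrightarrow>
     linear T \<and> (\<forall>x\<ge>0. 0 \<le> T x) \<and> order_continuous T \<and> T \<circ> T = T \<and>
     dedekind_complete_subspace (range T) \<and>
     (\<forall>u. weak_order_unit u \<longrightarrow> weak_order_unit (T u))"

definition strictly_positive :: "('a::riesz_space \<Rightarrow> 'a) \<Rightarrow> bool" where
  "strictly_positive T \<longleftrightarrow> (\<forall>x\<ge>0. T x = 0 \<longrightarrow> x = 0)"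

text \<open>
  Index sets inside the space suffice in the next definition: an increasing net and the
  inclusion map of its range, which is upward directed, have the same order limits.
\<close>

definition universally_complete :: "('a::riesz_space \<Rightarrow> 'a) \<Rightarrow> bool" where
  "universally_complete T \<longleftrightarrow>
     (\<forall>(I :: 'a set) r f.
        directed_preorder I r \<longrightarrow> (\<forall>i\<in>I. \<forall>j\<in>I. r i j \<longrightarrow> f i \<le> f j) \<longrightarrow> (\<forall>i\<in>I. 0 \<le> f i) \<longrightarrow>
        (\<exists>a b. (\<lambda>i. T (f i)) ` I \<subseteq> {a..b}) \<longrightarrow>
        (\<exists>l. order_conv f l (tails I r)))"

text \<open>
  The conditional expectation with range \<open>F\<close> compatible with \<open>T\<close>. It is only meaningful
  when \<open>F\<close> is a closed Riesz subspace containing the range of \<open>T\<close>, where it exists and is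
  unique if \<open>T\<close> is strictly positive, the space is universally complete for \<open>T\<close>, and \<open>T\<close>
  fixes a weak order unit.
\<close>

definition cond_exp_onto :: "('a::riesz_space \<Rightarrow> 'a) \<Rightarrow> 'a set \<Rightarrow> 'a \<Rightarrow> 'a" where
  "cond_exp_onto T F =
     (THE S. conditional_expectation S \<and> range S = F \<and> T \<circ> S = T \<and> S \<circ> T = T)"

section \<open>Processes\<close>

definition process_space :: "('a::riesz_space \<Rightarrow> 'a) \<Rightarrow> ('i \<Rightarrow> 'a) \<Rightarrow> 'i set \<Rightarrow> 'a set" where
  "process_space T X A = closed_riesz_span (range T \<union> X ` A)"

definition process_exp :: "('a::riesz_space \<Rightarrow> 'a) \<Rightarrow> ('i \<Rightarrow> 'a) \<Rightarrow> 'i set \<Rightarrow> 'a \<Rightarrow> 'a" where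
  "process_exp T X A = cond_exp_onto T (process_space T X A)"

text \<open>The strictly increasing list \<open>ts\<close> is \<open>t\<^sub>1 < \<dots> < t\<^sub>n\<close> with \<open>n \<ge> 1\<close>.\<close>

definition markov_process ::
  "('a::riesz_space \<Rightarrow> 'a) \<Rightarrow> 'a \<Rightarrow> ('i::linorder \<Rightarrow> 'a) \<Rightarrow> bool" where
  "markov_process T e X \<longleftrightarrow>
     (\<forall>ts t P. ts \<noteq> [] \<longrightarrow> sorted_wrt (<) (ts @ [t]) \<longrightarrow>
        band_projection P \<longrightarrow> P e \<in> process_space T X {t} \<longrightarrow>
        process_exp T X (set ts) (P e) = process_exp T X {last ts} (P e))"

end

theory Submission
  imports Defs
begin

text \<open>
  The conditional expectation \<open>T\<^sub>F f\<close> is the element \<open>g\<close> of \<open>F\<close> with \<open>T (P g) = T (P f)\<close> for all band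
  projections \<open>P\<close> with \<open>P e \<in> F\<close>; it exists by a Radon-Nikodym argument and is unique by strict
  positivity. Hence it suffices to test against components of \<open>e\<close>, and a test that vanishes on a
  family of projections closed under composition vanishes on the closed Riesz subspace this family
  generates, since that subspace lies in the closure of its simple elements for the vector-valued
  seminorm \<open>T \<bar>x\<bar>\<close>. This passes from finitely many times to the whole past in (ii). For (iii), the
  equation \<open>T\<^sub>H (P (T\<^sub>H (Q e))) = T\<^sub>H (P (Q e))\<close> for all \<open>P\<close> from \<open>F\<close> says that
  \<open>T\<^sub>K (Q e) = T\<^sub>H (Q e)\<close>, where \<open>K\<close> is generated by \<open>F\<close> and \<open>H\<close>; being symmetric in \<open>P\<close> and \<open>Q\<close>, it
  turns the one-step Markov property into an induction over the future times.
\<close>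

section \<open>Riesz spaces\<close>

text \<open>No multiplication on \<open>E\<close> is given, so the measure-theoretic dictionary is
  kept at the level of operators: a component \<open>P e\<close> is the indicator of an event,
  \<open>P\<close> is multiplication by it, and composition is intersection. This is faithful
  because a projection is determined by its value at \<open>e\<close> and projections commute. Two
  obstacles shape the rest. Values of \<open>T\<close> are vectors and need not be comparable with
  zero, so the sign arguments in the Radon-Nikodym part are localised by projections coming from
  \<open>range T\<close>, which commute with \<open>T\<close>. And a generated subspace is given
  only as an intersection: to place it inside a set, that set must be known to be a closed Riesz
  subspace, whereas the solutions of a linear equation rarely form a sublattice. Approximating
  indicators \<open>S e\<close> by simple elements \<open>A e\<close> avoids this, since
  \<open>S - A\<close> acts like multiplication by \<open>S e - A e\<close>, so that its value at
  any \<open>h\<close> with \<open>\<bar>h\<bar> \<le> e\<close> is dominated by its value at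
  \<open>e\<close>.\<close>

lemma pprt_diff: "pprt x - pprt (- x) = (x::'a::lattice_ab_group_add)"
  using prts[of x] pprt_neg[of x] by simp

lemma abs_eq_pprt: "\<bar>x\<bar> = pprt x + pprt (- x)" for x :: "'a::lattice_ab_group_add_abs"
  by (simp add: abs_prts pprt_neg)

lemma inf_pprt: "inf (pprt x) (pprt (- x)) = (0::'a::lattice_ab_group_add)"
proof -
  have "inf (pprt x) (pprt (- x)) = inf (x + pprt (- x)) (0 + pprt (- x))"
    using pprt_diff[of x] by (metis add.left_neutral diff_add_cancel)
  also have "\<dots> = nprt x + pprt (- x)"
    by (simp only: nprt_def add_inf_distrib_right)
  finally show ?thesis by (simp add: pprt_neg)
qed

lemma abs_diff_eq: "\<bar>a - b\<bar> = sup a b - inf a b" for a :: "'a::lattice_ab_group_add_abs"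
proof -
  have "sup a b = sup (a - b) 0 + b" "inf a b = inf (a - b) 0 + b"
    by (simp_all only: add_sup_distrib_right add_inf_distrib_right) simp_all
  then show ?thesis
    by (simp only: abs_prts pprt_def nprt_def) (simp add: algebra_simps del: diff_inf_eq_sup)
qed

lemma abs_diff_disjoint:
  "inf a b = 0 \<Longrightarrow> \<bar>a - b\<bar> = a + b" for a :: "'a::lattice_ab_group_add_abs"
  by (simp add: abs_diff_eq add_eq_inf_sup[of a b])

lemma inf_add_le:
  fixes x y z :: "'a::lattice_ab_group_add"
  assumes "0 \<le> x" "0 \<le> y" "0 \<le> z"
  shows "inf (x + y) z \<le> inf x z + inf y z"
proof -
  have "inf (x + y) z - inf y z \<le> x"
    using assms by (simp add: diff_le_eq add_inf_distrib_left le_infI2 del: diff_inf_eq_sup)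
  moreover have "inf (x + y) z - inf y z \<le> z"
    using assms by (simp add: diff_le_eq add_inf_distrib_left le_infI2 del: diff_inf_eq_sup)
  ultimately show ?thesis by (metis diff_le_eq le_infI)
qed

lemma add_inf_le:
  fixes x y z :: "'a::lattice_ab_group_add"
  shows "inf x u + inf y v \<le> inf (x + y) (u + v)"
  by (simp add: add_mono)

lemma scaleR_inf:
  fixes x y :: "'a::riesz_space"
  assumes "0 < c"
  shows "c *\<^sub>R inf x y = inf (c *\<^sub>R x) (c *\<^sub>R y)"
proof (rule antisym)
  show "c *\<^sub>R inf x y \<le> inf (c *\<^sub>R x) (c *\<^sub>R y)"
    using assms by (simp add: scaleR_left_mono)
  have "(1/c) *\<^sub>R inf (c *\<^sub>R x) (c *\<^sub>R y) \<le> (1/c) *\<^sub>R (c *\<^sub>R x)"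
       "(1/c) *\<^sub>R inf (c *\<^sub>R x) (c *\<^sub>R y) \<le> (1/c) *\<^sub>R (c *\<^sub>R y)"
    using assms by (intro scaleR_left_mono; simp)+
  then have "(1/c) *\<^sub>R inf (c *\<^sub>R x) (c *\<^sub>R y) \<le> inf x y" using assms by simp
  then have "c *\<^sub>R ((1/c) *\<^sub>R inf (c *\<^sub>R x) (c *\<^sub>R y)) \<le> c *\<^sub>R inf x y"
    using assms by (intro scaleR_left_mono) auto
  then show "inf (c *\<^sub>R x) (c *\<^sub>R y) \<le> c *\<^sub>R inf x y" using assms by simp
qed

lemma scaleR_sup:
  fixes x y :: "'a::riesz_space"
  assumes "0 < c"
  shows "c *\<^sub>R sup x y = sup (c *\<^sub>R x) (c *\<^sub>R y)"
  using scaleR_inf[OF assms, of "- x" "- y"]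
  by (simp only: sup_eq_neg_inf scaleR_minus_right)

lemma abs_scaleR: "\<bar>c *\<^sub>R x\<bar> = \<bar>c\<bar> *\<^sub>R \<bar>x\<bar>" for x :: "'a::riesz_space"
proof -
  have pos: "\<bar>d *\<^sub>R x\<bar> = d *\<^sub>R \<bar>x\<bar>" if "0 < d" for d and x :: 'a
    using scaleR_sup[OF that, of x "- x"] by (simp add: abs_lattice)
  consider "c = 0" | "0 < c" | "0 < - c" by linarith
  then show ?thesis
  proof cases
    case 3
    have "\<bar>c *\<^sub>R x\<bar> = \<bar>(- c) *\<^sub>R x\<bar>" by simp
    then show ?thesis using pos[OF 3, of x] 3 by simp
  qed (auto simp: pos)
qed

text \<open>Dedekind completeness supplies the infimum \<open>s\<close> of the dyadic multiples of
  \<open>y\<close>. Shifting the index by one shows that \<open>2 s\<close> is again a lower bound,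
  so \<open>2 s \<le> s\<close> and hence \<open>s \<le> 0\<close>.\<close>

lemma archimedean:
  fixes x y :: "'a::dedekind_complete_riesz_space"
  assumes "0 \<le> y" and "\<And>n. x \<le> (1/2) ^ n *\<^sub>R y"
  shows "x \<le> 0"
proof -
  let ?D = "range (\<lambda>n. (1/2) ^ n *\<^sub>R y)"
  define s where "s = Inf ?D"
  have bdd: "bdd_below ?D"
    using assms(1) by (auto intro!: bdd_belowI[of _ 0] scaleR_nonneg_nonneg)
  have "2 *\<^sub>R s \<le> (1/2) ^ n *\<^sub>R y" for n
  proof -
    have "s \<le> (1/2) ^ Suc n *\<^sub>R y" unfolding s_def by (rule cInf_lower[OF _ bdd]) blast
    then have "2 *\<^sub>R s \<le> 2 *\<^sub>R ((1/2) ^ Suc n *\<^sub>R y)" by (intro scaleR_left_mono) auto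
    then show ?thesis by simp
  qed
  then have "2 *\<^sub>R s \<le> s" unfolding s_def by (intro cInf_greatest) auto
  then have "s \<le> 0" by (simp add: scaleR_2)
  moreover have "x \<le> s" unfolding s_def using assms(2) by (intro cInf_greatest) auto
  ultimately show ?thesis by (rule order_trans[rotated])
qed

lemma eq_0_archimedean:
  fixes x y :: "'a::dedekind_complete_riesz_space"
  assumes "0 \<le> y" and "\<And>n. \<bar>x\<bar> \<le> (1/2) ^ n *\<^sub>R y"
  shows "x = 0"
  using archimedean[OF assms] by simp

section \<open>Positive operators\<close>

definition positive :: "('a::riesz_space \<Rightarrow> 'a) \<Rightarrow> bool" where
  "positive T \<longleftrightarrow> linear T \<and> (\<forall>x\<ge>0. 0 \<le> T x)"

lemma positive_linear: "positive T \<Longrightarrow> linear T"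
  and positive_nonneg: "positive T \<Longrightarrow> 0 \<le> x \<Longrightarrow> 0 \<le> T x"
  by (auto simp: positive_def)

lemma positive_mono: "positive T \<Longrightarrow> x \<le> y \<Longrightarrow> T x \<le> T y"
  using positive_nonneg[of T "y - x"] linear_diff[OF positive_linear] by fastforce

lemma positive_abs_le: "positive T \<Longrightarrow> \<bar>T x\<bar> \<le> T \<bar>x\<bar>"
proof -
  assume T: "positive T"
  have "T x \<le> T \<bar>x\<bar>" "T (- x) \<le> T \<bar>x\<bar>" by (auto intro!: positive_mono[OF T] abs_ge_self abs_ge_minus_self)
  then show ?thesis using linear_neg[OF positive_linear[OF T]] by (auto intro!: abs_leI)
qed

section \<open>Order convergence\<close>

lemma decreases_to_zeroI:
  assumes "D \<noteq> {}" "\<And>a b. a \<in> D \<Longrightarrow> b \<in> D \<Longrightarrow> \<exists>c\<in>D. c \<le> a \<and> c \<le> b" "\<And>d. d \<in> D \<Longrightarrow> 0 \<le> d"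
    "\<And>z. (\<And>d. d \<in> D \<Longrightarrow> z \<le> d) \<Longrightarrow> z \<le> 0"
  shows "decreases_to_zero D"
  using assms unfolding decreases_to_zero_def by blast

lemma decreases_to_zero_le: "decreases_to_zero D \<Longrightarrow> (\<And>d. d \<in> D \<Longrightarrow> z \<le> d) \<Longrightarrow> z \<le> 0"
  and decreases_to_zero_nonneg: "decreases_to_zero D \<Longrightarrow> d \<in> D \<Longrightarrow> 0 \<le> d"
  by (auto simp: decreases_to_zero_def)

text \<open>The tail filter of \<open>D\<close>, read as a net indexed by itself. It links families
  decreasing to zero with the filters that occur in \<open>order_closed\<close> and
  \<open>order_continuous\<close>.\<close>

lemma decreases_to_zero_filter:
  assumes "decreases_to_zero D"
  obtains F where "F \<noteq> bot" "\<And>d. d \<in> D \<Longrightarrow> eventually (\<lambda>x. x \<in> D \<and> x \<le> d) F"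
proof
  define F where "F = (INF d\<in>D. principal {x \<in> D. x \<le> d})"
  have ev: "eventually P F \<longleftrightarrow> (\<exists>d\<in>D. \<forall>x\<in>D. x \<le> d \<longrightarrow> P x)" for P
    unfolding F_def
  proof (subst eventually_INF_base)
    show "D \<noteq> {}" using assms by (simp add: decreases_to_zero_def)
    fix a b assume "a \<in> D" "b \<in> D"
    then obtain c where "c \<in> D" "c \<le> a" "c \<le> b"
      using assms unfolding decreases_to_zero_def by blast
    then show "\<exists>x\<in>D. principal {y \<in> D. y \<le> x}
        \<le> inf (principal {x \<in> D. x \<le> a}) (principal {x \<in> D. x \<le> b})"
      by (intro bexI[of _ c]) (auto dest: order_trans)
  qed (auto simp: eventually_principal)
  show "F \<noteq> bot" using ev[of "\<lambda>_. False"] by (metis eventually_bot order_refl)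
  show "eventually (\<lambda>x. x \<in> D \<and> x \<le> d) F" if "d \<in> D" for d
    using that by (subst ev) blast
qed

lemma order_closed_decreases:
  assumes "order_closed S" "decreases_to_zero D" "\<And>d. d \<in> D \<Longrightarrow> s - d \<in> S"
  shows "s \<in> S"
proof -
  obtain F where F: "F \<noteq> bot" "\<And>d. d \<in> D \<Longrightarrow> eventually (\<lambda>x. x \<in> D \<and> x \<le> d) F"
    using decreases_to_zero_filter[OF assms(2)] by blast
  obtain d0 where "d0 \<in> D" using assms(2) by (auto simp: decreases_to_zero_def)
  let ?F = "filtermap (\<lambda>d. s - d) F"
  have "?F \<noteq> bot" using F(1) by (simp add: filtermap_bot_iff)
  moreover have "eventually (\<lambda>x. x \<in> S) ?F"
    unfolding eventually_filtermap using F(2)[OF \<open>d0 \<in> D\<close>] assms(3)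
    by (auto elim: eventually_mono)
  moreover have "order_conv (\<lambda>x. x) s ?F"
    unfolding order_conv_def eventually_filtermap
  proof (intro exI[of _ D] conjI ballI assms(2))
    fix d assume "d \<in> D"
    show "eventually (\<lambda>x. \<bar>s - x - s\<bar> \<le> d) F"
      using F(2)[OF \<open>d \<in> D\<close>]
      by eventually_elim (simp add: abs_of_nonneg[OF decreases_to_zero_nonneg[OF assms(2)]])
  qed
  ultimately show ?thesis using assms(1) unfolding order_closed_def by blast
qed

text \<open>The replacement for epsilon arguments: the members of \<open>D\<close> are the
  admissible errors, and order continuity makes their images under \<open>T\<close>
  negligible.\<close>

lemma order_continuous_decreases:
  assumes "positive T" "order_continuous T" "decreases_to_zero D" "\<And>d. d \<in> D \<Longrightarrow> z \<le> T d"
  shows "z \<le> 0"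
proof -
  obtain F where F: "F \<noteq> bot" "\<And>d. d \<in> D \<Longrightarrow> eventually (\<lambda>x. x \<in> D \<and> x \<le> d) F"
    using decreases_to_zero_filter[OF assms(3)] by blast
  obtain d0 where "d0 \<in> D" using assms(3) by (auto simp: decreases_to_zero_def)
  have "order_conv (\<lambda>x. x) 0 F"
    unfolding order_conv_def
  proof (intro exI[of _ D] conjI ballI assms(3))
    fix d assume "d \<in> D"
    show "eventually (\<lambda>x. \<bar>x - 0\<bar> \<le> d) F"
      using F(2)[OF \<open>d \<in> D\<close>]
      by eventually_elim (simp add: abs_of_nonneg[OF decreases_to_zero_nonneg[OF assms(3)]])
  qed
  then have "order_conv T 0 F"
    using assms(2) linear_0[OF positive_linear[OF assms(1)]]
    unfolding order_continuous_def by metis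
  then obtain D' where D': "decreases_to_zero D'" "\<And>d. d \<in> D' \<Longrightarrow> eventually (\<lambda>x. \<bar>T x\<bar> \<le> d) F"
    unfolding order_conv_def by auto
  show ?thesis
  proof (rule decreases_to_zero_le[OF D'(1)])
    fix d assume "d \<in> D'"
    have "eventually (\<lambda>x. z \<le> d) F"
      using D'(2)[OF \<open>d \<in> D'\<close>] F(2)[OF \<open>d0 \<in> D\<close>]
      by eventually_elim (meson abs_ge_self assms(4) order_trans)
    then show "z \<le> d" using F(1) eventually_happens by fastforce
  qed
qed

lemma order_continuousI:
  fixes T :: "'a::riesz_space \<Rightarrow> 'a"
  assumes "positive T" and "\<And>D. decreases_to_zero D \<Longrightarrow> decreases_to_zero (T ` D)"
  shows "order_continuous T"
  unfolding order_continuous_def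
proof (intro allI impI)
  fix F and l :: 'a assume "order_conv (\<lambda>x. x) l F"
  then obtain D where D: "decreases_to_zero D" "\<And>d. d \<in> D \<Longrightarrow> eventually (\<lambda>x. \<bar>x - l\<bar> \<le> d) F"
    unfolding order_conv_def by auto
  show "order_conv T (T l) F"
    unfolding order_conv_def
  proof (intro exI[of _ "T ` D"] conjI ballI assms(2) D(1))
    fix y assume "y \<in> T ` D"
    then obtain d where d: "d \<in> D" "y = T d" by blast
    show "eventually (\<lambda>x. \<bar>T x - T l\<bar> \<le> y) F"
      using D(2)[OF d(1)]
    proof eventually_elim
      case (elim x)
      have "\<bar>T x - T l\<bar> \<le> T \<bar>x - l\<bar>"
        using positive_abs_le[OF assms(1), of "x - l"] linear_diff[OF positive_linear[OF assms(1)]]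
        by simp
      also have "\<dots> \<le> y" using elim d(2) positive_mono[OF assms(1)] by blast
      finally show ?case .
    qed
  qed
qed

lemma decreases_to_zero_image:
  assumes "positive T" "decreases_to_zero D" "\<And>z. (\<And>d. d \<in> D \<Longrightarrow> z \<le> T d) \<Longrightarrow> z \<le> 0"
  shows "decreases_to_zero (T ` D)"
proof (rule decreases_to_zeroI)
  show "\<exists>c\<in>T ` D. c \<le> a \<and> c \<le> b" if "a \<in> T ` D" "b \<in> T ` D" for a b
  proof -
    from that obtain x y where xy: "x \<in> D" "a = T x" "y \<in> D" "b = T y" by blast
    then obtain c where "c \<in> D" "c \<le> x" "c \<le> y"
      using assms(2) unfolding decreases_to_zero_def by blast
    then show ?thesis using xy by (intro bexI[of _ "T c"]) (auto intro: positive_mono[OF assms(1)])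
  qed
  show "0 \<le> y" if "y \<in> T ` D" for y
    using that positive_nonneg[OF assms(1) decreases_to_zero_nonneg[OF assms(2)]] by blast
  show "T ` D \<noteq> {}" using assms(2) by (auto simp: decreases_to_zero_def)
  show "z \<le> 0" if "\<And>d. d \<in> T ` D \<Longrightarrow> z \<le> d" for z
    by (rule assms(3)) (rule that, rule imageI)
qed

section \<open>Order projections\<close>

text \<open>Multiplication by an indicator function, axiomatised without mention of a band;
  \<open>band_projection_iff\<close> identifies these operators with the band projections.\<close>

definition order_projection :: "('a::riesz_space \<Rightarrow> 'a) \<Rightarrow> bool" where
  "order_projection P \<longleftrightarrow> linear P \<and> (\<forall>x\<ge>0. 0 \<le> P x \<and> P x \<le> x) \<and> (\<forall>x. P (P x) = P x)"

context
  fixes P :: "'a::riesz_space \<Rightarrow> 'a"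
  assumes P: "order_projection P"
begin

lemma order_projection_linear: "linear P"
  and order_projection_positive: "positive P"
  and order_projection_nonneg: "0 \<le> x \<Longrightarrow> 0 \<le> P x"
  and order_projection_le: "0 \<le> x \<Longrightarrow> P x \<le> x"
  and order_projection_idem: "P (P x) = P x"
  using P by (auto simp: order_projection_def positive_def)

lemmas order_projection_mono = positive_mono[OF order_projection_positive]
  and order_projection_add = linear_add[OF order_projection_linear]
  and order_projection_diff = linear_diff[OF order_projection_linear]
  and order_projection_neg = linear_neg[OF order_projection_linear]
  and order_projection_scale = linear_scale[OF order_projection_linear]
  and order_projection_0 = linear_0[OF order_projection_linear]

lemma order_projection_compl: "order_projection (\<lambda>x. x - P x)"
  unfolding order_projection_def
  by (intro conjI linear_compose_sub linear_id[unfolded id_def] order_projection_linear)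
    (auto simp: order_projection_le order_projection_nonneg order_projection_idem
      order_projection_diff)

text \<open>The complement of \<open>P\<close> is monotone and annihilates \<open>P x\<close>, so it
  annihilates everything between zero and \<open>P x\<close>.\<close>

lemma order_projection_fixed:
  assumes "0 \<le> y" "y \<le> P x"
  shows "P y = y"
proof -
  have "y - P y \<le> P x - P (P x)"
    using positive_mono[of "\<lambda>x. x - P x", OF _ assms(2)] order_projection_compl
    by (simp add: order_projection_def positive_def)
  then show ?thesis using order_projection_le[OF assms(1)] order_projection_idem[of x] by simp
qed

lemma order_projection_disjoint:
  assumes "0 \<le> x" "0 \<le> y"
  shows "inf (P x) (y - P y) = 0"
proof -
  let ?w = "inf (P x) (y - P y)"
  have w: "0 \<le> ?w" using assms order_projection_le order_projection_nonneg
    by (simp del: diff_inf_eq_sup)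
  then have "P ?w = ?w" by (rule order_projection_fixed[OF _ inf.cobounded1])
  moreover have "P ?w \<le> P (y - P y)" by (rule order_projection_mono) simp
  ultimately have "?w \<le> 0" by (simp add: order_projection_diff order_projection_idem)
  then show ?thesis using w by (rule antisym)
qed

lemma order_projection_abs: "\<bar>P x\<bar> = P \<bar>x\<bar>"
proof -
  let ?p = "pprt x" and ?n = "pprt (- x)"
  have "inf (P ?p) (P ?n) \<le> inf ?p ?n"
    using order_projection_le by (meson inf_mono zero_le_pprt)
  then have "inf (P ?p) (P ?n) = 0"
    using order_projection_nonneg by (simp add: inf_pprt antisym)
  then have "\<bar>P ?p - P ?n\<bar> = P ?p + P ?n" by (rule abs_diff_disjoint)
  then show ?thesis
    using order_projection_diff order_projection_add by (metis abs_eq_pprt pprt_diff)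
qed

lemma order_projection_abs_le: "\<bar>P x\<bar> \<le> \<bar>x\<bar>"
  by (simp add: order_projection_abs order_projection_le)

end

text \<open>\<open>P\<close> and its complement both commute with the absolute value, so an element
  glued from \<open>x\<close> on the band and \<open>y\<close> off it can be treated piece by
  piece.\<close>

lemma order_projection_split_abs:
  assumes P: "order_projection P"
  shows "\<bar>P x + (y - P y)\<bar> = P \<bar>x\<bar> + (\<bar>y\<bar> - P \<bar>y\<bar>)"
proof -
  define z where "z = P x + (y - P y)"
  have 1: "P z = P x"
    by (simp add: z_def order_projection_add[OF P] order_projection_diff[OF P] order_projection_idem[OF P])
  note C = order_projection_abs[OF order_projection_compl[OF P]]
  have "\<bar>z\<bar> - P (\<bar>z\<bar>) = (\<bar>y\<bar>) - P (\<bar>y\<bar>)"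
    using C[of z] C[of y] 1 by (simp add: z_def)
  moreover have "P \<bar>z\<bar> = P \<bar>x\<bar>" using 1 by (metis order_projection_abs[OF P])
  ultimately have "\<bar>z\<bar> = P \<bar>x\<bar> + (\<bar>y\<bar> - P (\<bar>y\<bar>))"
    by (metis add.commute diff_add_cancel)
  then show ?thesis by (simp only: z_def)
qed

lemma eq_on_positive_cone:
  fixes f g :: "'a::riesz_space \<Rightarrow> 'a"
  assumes "linear f" "linear g" "\<And>x. 0 \<le> x \<Longrightarrow> f x = g x"
  shows "f x = g x"
proof -
  have "f (pprt x - pprt (- x)) = g (pprt x - pprt (- x))"
    using assms(3) by (simp add: linear_diff[OF assms(1)] linear_diff[OF assms(2)])
  then show ?thesis by (simp add: pprt_diff)
qed

text \<open>For positive \<open>x\<close> and a projection \<open>R\<close>, \<open>P (R x)\<close>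
  lies below \<open>R x\<close> and is therefore fixed by \<open>R\<close>. Taking for
  \<open>R\<close> first \<open>Q\<close> and then its complement shows that \<open>P Q\<close> and
  \<open>Q P\<close> both equal \<open>Q P Q\<close>.\<close>

lemma order_projection_commute:
  assumes P: "order_projection P" and Q: "order_projection Q"
  shows "P (Q x) = Q (P x)"
proof (rule eq_on_positive_cone[of "\<lambda>x. P (Q x)" "\<lambda>x. Q (P x)"])
  show "linear (\<lambda>x. P (Q x))" "linear (\<lambda>x. Q (P x))"
    using linear_compose[OF order_projection_linear order_projection_linear] P Q
    by (auto simp: o_def)
next
  fix x :: 'a assume x: "0 \<le> x"
  have aux: "R (P (R x)) = P (R x)" if "order_projection R" for R
    using order_projection_nonneg[OF that x]
    by (intro order_projection_fixed[OF that, where x = x] order_projection_nonneg[OF P]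
        order_projection_le[OF P])
  have "Q (P (x - Q x)) = 0" using aux[OF order_projection_compl[OF Q]] by simp
  then have "Q (P x) = Q (P (Q x))"
    by (simp add: order_projection_diff[OF P] order_projection_diff[OF Q])
  then show "P (Q x) = Q (P x)" using aux[OF Q] by simp
qed

lemma order_projection_compose:
  assumes P: "order_projection P" and Q: "order_projection Q"
  shows "order_projection (\<lambda>x. P (Q x))"
  unfolding order_projection_def
proof (intro conjI allI impI)
  show "linear (\<lambda>x. P (Q x))"
    using linear_compose[OF order_projection_linear[OF Q] order_projection_linear[OF P]]
    by (simp add: o_def)
  show "P (Q (P (Q x))) = P (Q x)" for x
    by (simp add: order_projection_commute[OF Q P] order_projection_idem[OF P] order_projection_idem[OF Q])
  fix x :: 'a assume "0 \<le> x"
  then show "0 \<le> P (Q x)" "P (Q x) \<le> x"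
    using order_projection_nonneg[OF P] order_projection_nonneg[OF Q]
      order_projection_le[OF P] order_projection_le[OF Q] order_trans by blast+
qed

lemma order_projection_id: "order_projection (\<lambda>x. x)"
  by (simp add: order_projection_def linear_id[unfolded id_def])

lemma order_projection_zero: "order_projection (\<lambda>x. 0)"
  by (simp add: order_projection_def linear_zero)

lemma order_projection_sum:
  assumes P: "order_projection P" and Q: "order_projection Q" and PQ: "\<And>x. P (Q x) = 0"
  shows "order_projection (\<lambda>x. P x + Q x)"
  unfolding order_projection_def
proof (intro conjI allI impI)
  show "linear (\<lambda>x. P x + Q x)"
    by (intro linear_compose_add order_projection_linear P Q)
  have QP: "Q (P x) = 0" for x using PQ order_projection_commute[OF P Q] by metis
  show "P (P x + Q x) + Q (P x + Q x) = P x + Q x" for x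
    by (simp add: order_projection_add[OF P] order_projection_add[OF Q] PQ QP
        order_projection_idem[OF P] order_projection_idem[OF Q])
  fix x :: 'a assume x: "0 \<le> x"
  show "0 \<le> P x + Q x" using order_projection_nonneg[OF P x] order_projection_nonneg[OF Q x] by simp
  have "Q (x - P x) \<le> x - P x" using order_projection_le[OF P x] by (intro order_projection_le[OF Q]) simp
  then show "P x + Q x \<le> x" by (simp add: order_projection_diff[OF Q] QP algebra_simps)
qed

text \<open>\<open>P\<close> composed with the complement of \<open>Q\<close> is a projection
  annihilating \<open>e\<close>. It both fixes and annihilates the meet of \<open>e\<close> with any
  of its positive values; this meet is thus zero, and a weak unit forces the value to be
  zero.\<close>

lemma order_projection_eqI:
  assumes e: "weak_order_unit e" and P: "order_projection P" and Q: "order_projection Q"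
    and eq: "P e = Q e"
  shows "P = Q"
proof -
  have *: "P x = P (Q x)" if P: "order_projection P" and Q: "order_projection Q" and eq: "P e = Q e"
    for P Q and x
  proof -
    let ?R = "\<lambda>x. P (x - Q x)"
    have R: "order_projection ?R" by (rule order_projection_compose[OF P order_projection_compl[OF Q]])
    have "?R e = 0" using eq by (simp add: order_projection_diff[OF P] order_projection_idem[OF P] flip: eq)
    have "?R x = 0" if x: "0 \<le> x" for x
    proof -
      have nn: "0 \<le> inf e (?R x)"
        using e order_projection_nonneg[OF R x] by (simp add: weak_order_unit_def)
      have "inf e (?R x) = ?R (inf e (?R x))"
        by (rule order_projection_fixed[OF R nn, symmetric, where x = x]) simp
      also have "\<dots> \<le> ?R e" by (rule order_projection_mono[OF R]) simp
      finally have "inf e (?R x) = 0" using nn \<open>?R e = 0\<close> by (simp add: antisym)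
      then show ?thesis using e order_projection_nonneg[OF R x]
        by (simp add: weak_order_unit_def abs_of_nonneg)
    qed
    then have "?R x = 0"
      using eq_on_positive_cone[of ?R "\<lambda>x. 0" x] order_projection_linear[OF R] linear_zero by blast
    then show ?thesis by (simp add: order_projection_diff[OF P])
  qed
  show ?thesis
    using *[OF P Q eq] *[OF Q P eq[symmetric]] order_projection_commute[OF P Q] by (intro ext) metis
qed

subsection \<open>Band projections\<close>

lemma subspace_disjoint_complement: "subspace (disjoint_complement B)"
  for B :: "'a::riesz_space set"
  unfolding subspace_def disjoint_complement_def
proof (intro conjI ballI allI CollectI)
  show "inf \<bar>0\<bar> \<bar>y\<bar> = 0" for y :: 'a by (simp add: inf_absorb1)
  fix x :: 'a assume x: "x \<in> {x. \<forall>y\<in>B. inf \<bar>x\<bar> \<bar>y\<bar> = 0}"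
  fix y :: 'a assume y: "y \<in> {x. \<forall>y\<in>B. inf \<bar>x\<bar> \<bar>y\<bar> = 0}"
  fix b assume "b \<in> B"
  have "inf \<bar>x + y\<bar> \<bar>b\<bar> \<le> inf (\<bar>x\<bar> + \<bar>y\<bar>) \<bar>b\<bar>" by (intro inf_mono abs_triangle_ineq order_refl)
  also have "\<dots> \<le> inf \<bar>x\<bar> \<bar>b\<bar> + inf \<bar>y\<bar> \<bar>b\<bar>" by (intro inf_add_le) auto
  also have "\<dots> = 0" using x y \<open>b \<in> B\<close> by simp
  finally show "inf \<bar>x + y\<bar> \<bar>b\<bar> = 0" by (simp add: antisym)
next
  fix c :: real and x :: 'a assume x: "x \<in> {x. \<forall>y\<in>B. inf \<bar>x\<bar> \<bar>y\<bar> = 0}"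
  fix b assume b: "b \<in> B"
  \<comment> \<open>A factor that is at least 1 and at least \<open>\<bar>c\<bar>\<close> can be put
    on both arguments of the meet and then pulled out.\<close>
  let ?m = "max 1 \<bar>c\<bar>"
  have "inf \<bar>c *\<^sub>R x\<bar> \<bar>b\<bar> \<le> inf (?m *\<^sub>R \<bar>x\<bar>) (?m *\<^sub>R \<bar>b\<bar>)"
    using scaleR_right_mono[of 1 ?m "\<bar>b\<bar>"] unfolding abs_scaleR
    by (intro inf_mono scaleR_right_mono) auto
  also have "\<dots> = ?m *\<^sub>R inf \<bar>x\<bar> \<bar>b\<bar>" by (rule scaleR_inf[symmetric]) simp
  also have "\<dots> = 0" using x b by simp
  finally show "inf \<bar>c *\<^sub>R x\<bar> \<bar>b\<bar> = 0" by (simp add: antisym)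
qed

lemma order_projection_imp_band_projection:
  fixes P :: "'a::riesz_space \<Rightarrow> 'a"
  assumes P: "order_projection P"
  shows "band_projection P"
proof -
  have rng: "x \<in> range P \<longleftrightarrow> P x = x" for x using order_projection_idem[OF P] by (metis rangeE rangeI)
  have "band (range P)"
    unfolding band_def
  proof (intro conjI allI impI)
    show "subspace (range P)"
      using linear_subspace_image[OF order_projection_linear[OF P] subspace_UNIV] .
    fix x y :: 'a assume y: "y \<in> range P" and xy: "\<bar>x\<bar> \<le> \<bar>y\<bar>"
    have "P \<bar>x\<bar> = \<bar>x\<bar>"
      using y xy order_projection_abs[OF P, of y] rng
      by (intro order_projection_fixed[OF P, where x = "\<bar>y\<bar>"]) auto
    then have "\<bar>x - P x\<bar> = 0" using order_projection_abs[OF order_projection_compl[OF P], of x] by simp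
    then show "x \<in> range P" using rng by simp
  next
    show "order_closed (range P)"
      unfolding order_closed_def
    proof (intro allI impI)
      fix F :: "'a filter" and l
      assume F: "F \<noteq> bot" and ev: "eventually (\<lambda>x. x \<in> range P) F" and c: "order_conv (\<lambda>x. x) l F"
      then obtain D where D: "decreases_to_zero D" "\<And>d. d \<in> D \<Longrightarrow> eventually (\<lambda>x. \<bar>x - l\<bar> \<le> d) F"
        unfolding order_conv_def by auto
      have "\<bar>l - P l\<bar> \<le> 0"
      proof (rule decreases_to_zero_le[OF D(1)])
        fix d assume "d \<in> D"
        have "eventually (\<lambda>x. \<bar>l - P l\<bar> \<le> d) F"
          using D(2)[OF \<open>d \<in> D\<close>] ev
        proof eventually_elim
          case (elim x)
          have "l - P l = (l - x) - P (l - x)" using elim(2) rng by (simp add: order_projection_diff[OF P])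
          then have "\<bar>l - P l\<bar> \<le> \<bar>l - x\<bar>"
            using order_projection_abs_le[OF order_projection_compl[OF P]] by metis
          then show ?case using elim(1) by (simp add: abs_minus_commute)
        qed
        then show "\<bar>l - P l\<bar> \<le> d" using F eventually_happens by fastforce
      qed
      then show "l \<in> range P" using rng by simp
    qed
  qed
  moreover have "x - P x \<in> disjoint_complement (range P)" for x
    unfolding disjoint_complement_def
    using order_projection_disjoint[OF P abs_ge_zero abs_ge_zero, of _ x]
      order_projection_abs[OF P] order_projection_abs[OF order_projection_compl[OF P]]
    by (auto simp: inf_commute)
  ultimately show ?thesis unfolding band_projection_def by blast
qed

lemma band_projection_imp_order_projection:
  fixes P :: "'a::riesz_space \<Rightarrow> 'a"
  assumes "band_projection P"
  shows "order_projection P"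
proof -
  obtain B where B: "band B" and PB: "\<And>x. P x \<in> B" and PD: "\<And>x. x - P x \<in> disjoint_complement B"
    using assms unfolding band_projection_def by blast
  have sB: "subspace B" using B by (simp add: band_def)
  note sD = subspace_disjoint_complement[of B]
  \<comment> \<open>The decomposition along \<open>B\<close> and its complement is unique, since the
    difference of two candidates lies in both. Linearity and idempotence then follow by exhibiting a
    candidate.\<close>
  have uniq: "P x = b" if "b \<in> B" "x - b \<in> disjoint_complement B" for x b
  proof -
    have "(x - b) - (x - P x) \<in> disjoint_complement B" by (rule subspace_diff[OF sD that(2) PD])
    moreover have "P x - b \<in> B" by (rule subspace_diff[OF sB PB that(1)])
    ultimately have "inf \<bar>P x - b\<bar> \<bar>P x - b\<bar> = 0"
      unfolding disjoint_complement_def mem_Collect_eq by (metis diff_diff_eq2 diff_add_cancel add.commute add_diff_cancel_left')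
    then show ?thesis by simp
  qed
  have "linear P"
  proof (rule linearI)
    show "P (x + y) = P x + P y" for x y
      by (rule uniq[OF subspace_add[OF sB PB PB]])
        (use subspace_add[OF sD PD PD, of x y] in \<open>simp add: algebra_simps\<close>)
    show "P (c *\<^sub>R x) = c *\<^sub>R P x" for c x
      by (rule uniq[OF subspace_scale[OF sB PB]])
        (use subspace_scale[OF sD PD, of c x] in \<open>simp add: algebra_simps\<close>)
  qed
  moreover have "0 \<le> P x \<and> P x \<le> x" if "0 \<le> x" for x
  proof -
    have "inf \<bar>x - P x\<bar> \<bar>P x\<bar> = 0" using PD[of x] PB[of x] by (simp add: disjoint_complement_def)
    then have d: "inf \<bar>P x\<bar> \<bar>x - P x\<bar> = 0" by (simp add: inf_commute)
    have "x = \<bar>P x + (x - P x)\<bar>" using that by simp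
    also have "\<dots> = \<bar>P x\<bar> + \<bar>x - P x\<bar>"
    proof (rule antisym[OF abs_triangle_ineq])
      have "\<bar>P x\<bar> + \<bar>x - P x\<bar> = \<bar>\<bar>P x\<bar> - \<bar>x - P x\<bar>\<bar>" by (rule abs_diff_disjoint[OF d, symmetric])
      also have "\<dots> \<le> \<bar>P x - - (x - P x)\<bar>" using abs_triangle_ineq3[of "P x" "- (x - P x)"] by (simp only: abs_minus_cancel)
      finally show "\<bar>P x\<bar> + \<bar>x - P x\<bar> \<le> \<bar>P x + (x - P x)\<bar>" by simp
    qed
    finally have x: "x = \<bar>P x\<bar> + \<bar>x - P x\<bar>" .
    \<comment> \<open>Each of \<open>P x\<close> and \<open>x - P x\<close> is at most its absolute
      value while the sums agree, so both are nonnegative.\<close>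
    have "\<bar>P x\<bar> + \<bar>x - P x\<bar> = P x + (x - P x)" using x by simp
    moreover have "P x \<le> \<bar>P x\<bar>" "x - P x \<le> \<bar>x - P x\<bar>" by (rule abs_ge_self)+
    ultimately have "P x = \<bar>P x\<bar>" "x - P x = \<bar>x - P x\<bar>"
      by (metis add_le_cancel_left add_le_cancel_right antisym)+
    then show ?thesis by (metis abs_ge_zero diff_ge_0_iff_ge)
  qed
  moreover have "P (P x) = P x" for x
    by (rule uniq[OF PB]) (simp add: subspace_0[OF sD])
  ultimately show ?thesis unfolding order_projection_def by blast
qed

lemma band_projection_iff: "band_projection P \<longleftrightarrow> order_projection P"
  using order_projection_imp_band_projection band_projection_imp_order_projection by blast

subsection \<open>Principal projections\<close>

text \<open>For \<open>u, x \<ge> 0\<close> this is the component of \<open>x\<close> in the band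
  generated by \<open>u\<close>. The set is bounded by \<open>x\<close>, so Dedekind completeness
  provides the supremum.\<close>

definition cut_sup :: "'a::dedekind_complete_riesz_space \<Rightarrow> 'a \<Rightarrow> 'a" where
  "cut_sup u x = Sup ((\<lambda>t. inf x (t *\<^sub>R u)) ` {0..})"

context
  fixes u :: "'a::dedekind_complete_riesz_space"
  assumes u: "0 \<le> u"
begin

lemma cut_sup_upper: "0 \<le> t \<Longrightarrow> inf x (t *\<^sub>R u) \<le> cut_sup u x"
  unfolding cut_sup_def by (rule cSup_upper) (auto intro!: bdd_aboveI[of _ x])

lemma cut_sup_least: "(\<And>t. 0 \<le> t \<Longrightarrow> inf x (t *\<^sub>R u) \<le> z) \<Longrightarrow> cut_sup u x \<le> z"
  unfolding cut_sup_def by (rule cSup_least) auto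

lemma cut_sup_le: "cut_sup u x \<le> x"
  by (rule cut_sup_least) simp

lemma cut_sup_nonneg: "0 \<le> x \<Longrightarrow> 0 \<le> cut_sup u x"
  using cut_sup_upper[of 0 x] by (simp add: inf_absorb2)

lemma cut_sup_add:
  assumes x: "0 \<le> x" and y: "0 \<le> y"
  shows "cut_sup u (x + y) = cut_sup u x + cut_sup u y"
proof (rule antisym)
  show "cut_sup u (x + y) \<le> cut_sup u x + cut_sup u y"
  proof (rule cut_sup_least)
    fix t :: real assume t: "0 \<le> t"
    have "inf (x + y) (t *\<^sub>R u) \<le> inf x (t *\<^sub>R u) + inf y (t *\<^sub>R u)"
      using x y u t by (intro inf_add_le) (auto intro: scaleR_nonneg_nonneg)
    then show "inf (x + y) (t *\<^sub>R u) \<le> cut_sup u x + cut_sup u y"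
      using cut_sup_upper[OF t] by (meson add_mono order_trans)
  qed
  have "inf x (t *\<^sub>R u) \<le> cut_sup u (x + y) - cut_sup u y" if t: "0 \<le> t" for t
  proof -
    have "cut_sup u y \<le> cut_sup u (x + y) - inf x (t *\<^sub>R u)"
    proof (rule cut_sup_least)
      fix s :: real assume s: "0 \<le> s"
      have "inf x (t *\<^sub>R u) + inf y (s *\<^sub>R u) \<le> inf (x + y) ((t + s) *\<^sub>R u)"
        using add_inf_le[of x "t *\<^sub>R u" y "s *\<^sub>R u"] by (simp add: scaleR_add_left)
      also have "\<dots> \<le> cut_sup u (x + y)" using s t by (intro cut_sup_upper) simp
      finally show "inf y (s *\<^sub>R u) \<le> cut_sup u (x + y) - inf x (t *\<^sub>R u)"
        by (simp add: le_diff_eq add.commute del: diff_inf_eq_sup)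
    qed
    then show ?thesis by (simp add: le_diff_eq add.commute del: diff_inf_eq_sup)
  qed
  then have "cut_sup u x \<le> cut_sup u (x + y) - cut_sup u y" by (rule cut_sup_least)
  then show "cut_sup u x + cut_sup u y \<le> cut_sup u (x + y)" by (simp add: le_diff_eq)
qed

lemma cut_sup_scale:
  assumes c: "0 < c"
  shows "cut_sup u (c *\<^sub>R x) = c *\<^sub>R cut_sup u x"
proof -
  have le: "cut_sup u (c *\<^sub>R x) \<le> c *\<^sub>R cut_sup u x" if c: "0 < c" for c x
  proof (rule cut_sup_least)
    fix t :: real assume "0 \<le> t"
    have "inf (c *\<^sub>R x) (t *\<^sub>R u) = c *\<^sub>R inf x ((t / c) *\<^sub>R u)" using c by (simp add: scaleR_inf)
    also have "\<dots> \<le> c *\<^sub>R cut_sup u x" using c \<open>0 \<le> t\<close> by (intro scaleR_left_mono cut_sup_upper) auto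
    finally show "inf (c *\<^sub>R x) (t *\<^sub>R u) \<le> c *\<^sub>R cut_sup u x" .
  qed
  have "cut_sup u x \<le> (1 / c) *\<^sub>R cut_sup u (c *\<^sub>R x)"
    using le[of "1 / c" "c *\<^sub>R x"] c by simp
  then have "c *\<^sub>R cut_sup u x \<le> c *\<^sub>R ((1 / c) *\<^sub>R cut_sup u (c *\<^sub>R x))"
    using c by (intro scaleR_left_mono) auto
  then show ?thesis using le[OF c, of x] c by (simp add: antisym)
qed

lemma cut_sup_self: "cut_sup u u = u"
  using cut_sup_upper[of 1 u] cut_sup_le[of u] by simp

lemma cut_sup_idem: "cut_sup u (cut_sup u x) = cut_sup u x"
proof (rule antisym[OF cut_sup_le cut_sup_least])
  fix t :: real assume t: "0 \<le> t"
  have "inf x (t *\<^sub>R u) \<le> inf (cut_sup u x) (t *\<^sub>R u)" using cut_sup_upper[OF t] by simp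
  also have "\<dots> \<le> cut_sup u (cut_sup u x)" by (rule cut_sup_upper[OF t])
  finally show "inf x (t *\<^sub>R u) \<le> cut_sup u (cut_sup u x)" .
qed

definition proj :: "'a \<Rightarrow> 'a" where
  "proj x = cut_sup u (pprt x) - cut_sup u (pprt (- x))"

text \<open>Independence of the chosen decomposition into positive elements; with additivity on the
  positive cone this is the usual extension to a linear map.\<close>

lemma proj_diff:
  assumes "0 \<le> a" "0 \<le> b"
  shows "proj (a - b) = cut_sup u a - cut_sup u b"
proof -
  have "pprt (a - b) + b = pprt (- (a - b)) + a" using pprt_diff[of "a - b"] by (simp add: algebra_simps)
  then have "cut_sup u (pprt (a - b)) + cut_sup u b = cut_sup u (pprt (- (a - b))) + cut_sup u a"
    using assms by (metis cut_sup_add zero_le_pprt)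
  then show ?thesis unfolding proj_def by (simp add: algebra_simps)
qed

lemma proj_pos: "0 \<le> x \<Longrightarrow> proj x = cut_sup u x"
  using proj_diff[of x 0] cut_sup_le[of 0] cut_sup_nonneg[of 0] by simp

lemma order_projection_proj: "order_projection proj"
proof -
  have "linear proj"
  proof (rule linearI)
    fix x y :: 'a
    have "x + y = (pprt x + pprt y) - (pprt (- x) + pprt (- y))"
      using pprt_diff[of x] pprt_diff[of y] by (metis add_diff_add)
    then have "proj (x + y) = cut_sup u (pprt x + pprt y) - cut_sup u (pprt (- x) + pprt (- y))"
      by (metis add_nonneg_nonneg proj_diff zero_le_pprt)
    then show "proj (x + y) = proj x + proj y" by (simp add: cut_sup_add proj_def)
  next
    fix c :: real and x :: 'a
    consider "c = 0" | "0 < c" | "0 < - c" by linarith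
    then show "proj (c *\<^sub>R x) = c *\<^sub>R proj x"
    proof cases
      case 1 then show ?thesis using proj_diff[of 0 0] by simp
    next
      case 2
      have "proj (c *\<^sub>R x) = proj (c *\<^sub>R pprt x - c *\<^sub>R pprt (- x))"
        by (metis pprt_diff scaleR_diff_right)
      also have "\<dots> = c *\<^sub>R proj x"
        using 2 by (subst proj_diff) (auto simp: cut_sup_scale proj_def scaleR_diff_right intro: scaleR_nonneg_nonneg)
      finally show ?thesis .
    next
      case 3
      have "c *\<^sub>R x = c *\<^sub>R (pprt x - pprt (- x))" by (simp only: pprt_diff)
      also have "\<dots> = (- c) *\<^sub>R pprt (- x) - (- c) *\<^sub>R pprt x" by (simp add: algebra_simps)
      finally have "proj (c *\<^sub>R x) = proj ((- c) *\<^sub>R pprt (- x) - (- c) *\<^sub>R pprt x)" by simp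
      also have "\<dots> = (- c) *\<^sub>R cut_sup u (pprt (- x)) - (- c) *\<^sub>R cut_sup u (pprt x)"
        using 3 cut_sup_scale[OF 3]
        by (subst proj_diff) (auto intro: scaleR_nonneg_nonneg simp del: scaleR_minus_left)
      also have "\<dots> = c *\<^sub>R proj x" by (simp add: proj_def algebra_simps)
      finally show ?thesis .
    qed
  qed
  moreover have "proj (proj x) = proj x" for x
  proof -
    have "proj (proj x) = cut_sup u (cut_sup u (pprt x)) - cut_sup u (cut_sup u (pprt (- x)))"
      unfolding proj_def[of x] by (rule proj_diff) (simp_all add: cut_sup_nonneg)
    then show ?thesis by (simp add: cut_sup_idem proj_def[of x])
  qed
  ultimately show ?thesis
    unfolding order_projection_def by (auto simp: proj_pos cut_sup_nonneg cut_sup_le)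
qed

lemma proj_self: "proj u = u"
  by (simp add: proj_pos u cut_sup_self)

lemma proj_disjoint:
  assumes "0 \<le> x" "inf x u = 0"
  shows "proj x = 0"
proof -
  have "inf x (t *\<^sub>R u) \<le> 0" if t: "0 \<le> t" for t
  proof -
    let ?m = "max 1 t"
    have "inf x (t *\<^sub>R u) \<le> inf (?m *\<^sub>R x) (?m *\<^sub>R u)"
      using scaleR_right_mono[of 1 ?m x] scaleR_right_mono[of t ?m u] assms(1) u
      by (intro inf_mono) auto
    also have "\<dots> = ?m *\<^sub>R inf x u" by (rule scaleR_inf[symmetric]) simp
    finally show ?thesis using assms(2) by simp
  qed
  then have "cut_sup u x \<le> 0" by (rule cut_sup_least)
  then show ?thesis using assms(1) by (simp add: proj_pos cut_sup_nonneg antisym)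
qed

text \<open>Order convergence of the meets to the projection, in the shape that
  \<open>order_closed_decreases\<close> accepts. This is how projections inherit membership in
  closed subspaces.\<close>

lemma proj_decreases:
  assumes "0 \<le> x"
  shows "decreases_to_zero ((\<lambda>t. proj x - inf x (t *\<^sub>R u)) ` {0..})"
proof (rule decreases_to_zeroI)
  fix a b assume "a \<in> (\<lambda>t. proj x - inf x (t *\<^sub>R u)) ` {0..}" "b \<in> (\<lambda>t. proj x - inf x (t *\<^sub>R u)) ` {0..}"
  then obtain s t where st: "0 \<le> s" "0 \<le> t" "a = proj x - inf x (s *\<^sub>R u)" "b = proj x - inf x (t *\<^sub>R u)"
    by auto
  show "\<exists>c\<in>(\<lambda>t. proj x - inf x (t *\<^sub>R u)) ` {0..}. c \<le> a \<and> c \<le> b"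
    unfolding st(3,4)
    by (intro bexI[of _ "proj x - inf x (max s t *\<^sub>R u)"] conjI diff_left_mono inf_mono
        scaleR_right_mono u imageI order_refl) (use st in auto)
next
  fix z assume z: "\<And>d. d \<in> (\<lambda>t. proj x - inf x (t *\<^sub>R u)) ` {0..} \<Longrightarrow> z \<le> d"
  have "cut_sup u x \<le> cut_sup u x - z"
  proof (rule cut_sup_least)
    fix t :: real assume "0 \<le> t"
    then have "z \<le> proj x - inf x (t *\<^sub>R u)" by (intro z imageI) simp
    then show "inf x (t *\<^sub>R u) \<le> cut_sup u x - z"
      by (simp add: proj_pos assms le_diff_eq add.commute del: diff_inf_eq_sup)
  qed
  then show "z \<le> 0" by simp
qed (use assms cut_sup_upper in \<open>auto simp: proj_pos simp del: diff_inf_eq_sup\<close>)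

end

text \<open>\<open>e\<close> splits into \<open>P e\<close>, fixed by \<open>proj (P e)\<close>, and
  a part disjoint from it, so both projections agree at \<open>e\<close>. Hence the single element
  \<open>P e\<close> controls how \<open>P\<close> acts.\<close>

lemma order_projection_eq_proj:
  assumes e: "weak_order_unit e" and P: "order_projection P"
  shows "P = proj (P e)"
proof (rule order_projection_eqI[OF e P order_projection_proj])
  have e0: "0 \<le> e" using e by (simp add: weak_order_unit_def)
  show Pe: "0 \<le> P e" by (rule order_projection_nonneg[OF P e0])
  have "proj (P e) (P e + (e - P e)) = P e"
    unfolding order_projection_add[OF order_projection_proj[OF Pe]]
    using order_projection_le[OF P e0] order_projection_disjoint[OF P e0 e0]
    by (simp add: proj_self[OF Pe] proj_disjoint[OF Pe] inf_commute del: diff_inf_eq_sup)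
  then show "P e = proj (P e) e" by simp
qed

lemma proj_unit: "weak_order_unit e \<Longrightarrow> proj e x = x"
  using order_projection_eq_proj[of e "\<lambda>x. x"] order_projection_id by metis

lemma truncation_decreases:
  fixes e x :: "'a::dedekind_complete_riesz_space"
  assumes "weak_order_unit e" "0 \<le> x"
  shows "decreases_to_zero ((\<lambda>t. x - inf x (t *\<^sub>R e)) ` {0..})"
  using proj_decreases[of e x] assms by (simp add: proj_unit weak_order_unit_def del: diff_inf_eq_sup)

subsection \<open>Closed Riesz subspaces\<close>

definition closed_riesz :: "'a::riesz_space set \<Rightarrow> bool" where
  "closed_riesz F \<longleftrightarrow> riesz_subspace F \<and> order_closed F"

lemma riesz_subspace_subspace: "riesz_subspace F \<Longrightarrow> subspace F"
  and riesz_subspace_inf: "riesz_subspace F \<Longrightarrow> x \<in> F \<Longrightarrow> y \<in> F \<Longrightarrow> inf x y \<in> F"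
  and riesz_subspace_sup: "riesz_subspace F \<Longrightarrow> x \<in> F \<Longrightarrow> y \<in> F \<Longrightarrow> sup x y \<in> F"
  by (auto simp: riesz_subspace_def)

lemma riesz_subspace_pprt: "riesz_subspace F \<Longrightarrow> x \<in> F \<Longrightarrow> pprt x \<in> F"
  by (simp add: pprt_def riesz_subspace_sup riesz_subspace_subspace subspace_0)

text \<open>Supremum and infimum are half of \<open>x + y\<close> plus or minus
  \<open>\<bar>x - y\<bar>\<close>.\<close>

lemma riesz_subspaceI:
  assumes "subspace F" "\<And>x. x \<in> F \<Longrightarrow> \<bar>x\<bar> \<in> F"
  shows "riesz_subspace F"
proof -
  have "2 *\<^sub>R sup x y = (x + y) + \<bar>x - y\<bar>" "2 *\<^sub>R inf x y = (x + y) - \<bar>x - y\<bar>" for x y :: 'a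
    using add_eq_inf_sup[of x y] abs_diff_eq[of x y] by (simp_all add: scaleR_2 del: diff_inf_eq_sup)
  then have "sup x y = (1/2) *\<^sub>R ((x + y) + \<bar>x - y\<bar>)" "inf x y = (1/2) *\<^sub>R ((x + y) - \<bar>x - y\<bar>)" for x y :: 'a
    by (metis divide_eq_1_iff mult.commute nonzero_mult_div_cancel_right scaleR_one scaleR_scaleR times_divide_eq_left zero_neq_numeral)+
  then show ?thesis unfolding riesz_subspace_def
    using assms by (metis subspace_add subspace_diff subspace_scale)
qed

lemma closed_riesz_proj:
  fixes F :: "'a::dedekind_complete_riesz_space set"
  assumes F: "closed_riesz F" and u: "u \<in> F" "0 \<le> u" and x: "x \<in> F"
  shows "proj u x \<in> F"
proof -
  have rF: "riesz_subspace F" and sF: "subspace F" and cF: "order_closed F"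
    using F by (auto simp: closed_riesz_def riesz_subspace_def)
  have pos: "proj u x \<in> F" if x: "x \<in> F" "0 \<le> x" for x
    by (rule order_closed_decreases[OF cF proj_decreases[OF u(2) x(2)]])
      (auto intro!: riesz_subspace_inf[OF rF] x u(1) subspace_scale[OF sF] simp del: diff_inf_eq_sup)
  have "proj u (pprt x - pprt (- x)) \<in> F"
    unfolding order_projection_diff[OF order_projection_proj[OF u(2)]]
    by (intro subspace_diff[OF sF] pos riesz_subspace_pprt[OF rF] x subspace_neg[OF sF] zero_le_pprt)
  then show ?thesis by (simp only: pprt_diff)
qed

lemma closed_riesz_hull: "closed_riesz (closed_riesz_span S)"
  unfolding closed_riesz_span_def closed_riesz_def
proof (rule hull_in)
  fix \<F> :: "'a set set" assume *: "\<forall>F\<in>\<F>. riesz_subspace F \<and> order_closed F"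
  have "riesz_subspace (\<Inter>\<F>)"
    unfolding riesz_subspace_def
  proof (intro conjI ballI InterI subspace_Inter)
    fix x y F assume "x \<in> \<Inter>\<F>" "y \<in> \<Inter>\<F>" "F \<in> \<F>"
    then show "sup x y \<in> F" "inf x y \<in> F"
      using * riesz_subspace_sup riesz_subspace_inf by blast+
  qed (use * riesz_subspace_subspace in blast)
  moreover have "order_closed (\<Inter>\<F>)"
    unfolding order_closed_def
  proof (intro allI impI InterI)
    fix F :: "'a filter" and l G
    assume F: "F \<noteq> bot" "eventually (\<lambda>x. x \<in> \<Inter>\<F>) F" "order_conv (\<lambda>x. x) l F" and G: "G \<in> \<F>"
    have "eventually (\<lambda>x. x \<in> G) F" using F(2) by (rule eventually_mono) (use G in blast)
    then show "l \<in> G" using F(1,3) * G unfolding order_closed_def by blast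
  qed
  ultimately show "riesz_subspace (\<Inter>\<F>) \<and> order_closed (\<Inter>\<F>)" by blast
qed

lemma closed_riesz_span_minimal: "closed_riesz F \<Longrightarrow> S \<subseteq> F \<Longrightarrow> closed_riesz_span S \<subseteq> F"
  unfolding closed_riesz_span_def closed_riesz_def by (rule hull_minimal) auto

lemma closed_riesz_span_superset: "S \<subseteq> closed_riesz_span S"
  unfolding closed_riesz_span_def by (rule hull_subset)

section \<open>Maximal elements in partially ordered sets\<close>

lemma order_zorn:
  fixes A :: "'a::order set"
  assumes "A \<noteq> {}"
    and "\<And>C. C \<subseteq> A \<Longrightarrow> C \<noteq> {} \<Longrightarrow> (\<And>x y. x \<in> C \<Longrightarrow> y \<in> C \<Longrightarrow> x \<le> y \<or> y \<le> x) \<Longrightarrow> \<exists>u\<in>A. \<forall>x\<in>C. x \<le> u"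
  obtains m where "m \<in> A" "\<And>x. x \<in> A \<Longrightarrow> m \<le> x \<Longrightarrow> x = m"
proof -
  have "\<exists>m\<in>A. \<forall>a\<in>A. m \<le> a \<longrightarrow> a = m"
  proof (rule predicate_Zorn)
    show "partial_order_on A (relation_of (\<le>) A)"
      by (rule partial_order_on_relation_ofI) auto
    fix C assume "C \<in> Chains (relation_of (\<le>) A)"
    then have C: "C \<subseteq> A" "\<And>x y. x \<in> C \<Longrightarrow> y \<in> C \<Longrightarrow> x \<le> y \<or> y \<le> x"
      unfolding Chains_def relation_of_def by auto
    show "\<exists>u\<in>A. \<forall>a\<in>C. a \<le> u"
    proof (cases "C = {}")
      case True then show ?thesis using assms(1) by auto
    next
      case False then show ?thesis using assms(2)[OF C(1) False C(2)] by blast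
    qed
  qed
  then show ?thesis using that by blast
qed

subsection \<open>Averaging\<close>

text \<open>The range is the set of fixed points, and along a net of fixed points order continuity
  makes \<open>S l\<close> a limit besides \<open>l\<close>.\<close>

lemma closed_riesz_range:
  fixes S :: "'a::riesz_space \<Rightarrow> 'a"
  assumes S: "conditional_expectation S"
  shows "closed_riesz (range S)"
  unfolding closed_riesz_def
proof
  show "riesz_subspace (range S)"
    using S by (simp add: conditional_expectation_def dedekind_complete_subspace_def)
  have rng: "x \<in> range S \<longleftrightarrow> S x = x" for x
    using S unfolding conditional_expectation_def o_def by (metis rangeE rangeI)
  show "order_closed (range S)"
    unfolding order_closed_def
  proof (intro allI impI)
    fix F :: "'a filter" and l
    assume F: "F \<noteq> bot" and ev: "eventually (\<lambda>x. x \<in> range S) F" and c: "order_conv (\<lambda>x. x) l F"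
    have "order_conv S (S l) F" using c S by (simp add: conditional_expectation_def order_continuous_def)
    then obtain D' where D': "decreases_to_zero D'" "\<And>d. d \<in> D' \<Longrightarrow> eventually (\<lambda>x. \<bar>S x - S l\<bar> \<le> d) F"
      unfolding order_conv_def by auto
    obtain D where D: "decreases_to_zero D" "\<And>d. d \<in> D \<Longrightarrow> eventually (\<lambda>x. \<bar>x - l\<bar> \<le> d) F"
      using c unfolding order_conv_def by auto
    have "\<bar>S l - l\<bar> \<le> 0"
    proof (rule decreases_to_zero_le[OF D(1)])
      fix d assume d: "d \<in> D"
      have "\<bar>S l - l\<bar> - d \<le> 0"
      proof (rule decreases_to_zero_le[OF D'(1)])
        fix d' assume d': "d' \<in> D'"
        have "eventually (\<lambda>x. \<bar>S l - l\<bar> - d \<le> d') F"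
          using D(2)[OF d] D'(2)[OF d'] ev
        proof eventually_elim
          case (elim x)
          have "\<bar>S l - l\<bar> \<le> \<bar>S l - x\<bar> + \<bar>x - l\<bar>" using abs_triangle_ineq[of "S l - x" "x - l"] by simp
          also have "\<dots> \<le> d' + d" using elim rng by (metis abs_minus_commute add_mono)
          finally show ?case by (simp add: algebra_simps)
        qed
        then show "\<bar>S l - l\<bar> - d \<le> d'" using F eventually_happens by fastforce
      qed
      then show "\<bar>S l - l\<bar> \<le> d" by simp
    qed
    then show "l \<in> range S" using rng by simp
  qed
qed

lemma conditional_expectation_positive: "conditional_expectation S \<Longrightarrow> positive S"
  and conditional_expectation_continuous: "conditional_expectation S \<Longrightarrow> order_continuous S"
  and conditional_expectation_idem: "conditional_expectation S \<Longrightarrow> S (S x) = S x"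
  by (auto simp: conditional_expectation_def positive_def o_def fun_eq_iff)

text \<open>If \<open>x\<close> lies between zero and a multiple of \<open>e\<close>, then
  \<open>S (Q x)\<close> lies below a multiple of \<open>S (Q e) = Q e\<close>, hence in the range
  of \<open>Q\<close>. Truncation and order continuity of \<open>S\<close> extend this to all
  positive \<open>x\<close>.\<close>

lemma averaging:
  fixes S :: "'a::dedekind_complete_riesz_space \<Rightarrow> 'a"
  assumes S: "conditional_expectation S" and e: "weak_order_unit e" and Se: "S e = e"
    and P: "order_projection P" and Pe: "P e \<in> range S"
  shows "S (P x) = P (S x)"
proof -
  note Spos = conditional_expectation_positive[OF S]
  note Slin = positive_linear[OF Spos]
  have key: "S (Q x) = Q (S (Q x))" if Q: "order_projection Q" and Qe: "S (Q e) = Q e" and x: "0 \<le> x" for Q x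
  proof -
    let ?C = "\<lambda>y. y - Q y"
    note C = order_projection_compl[OF Q]
    have "?C (S (Q x)) \<le> 0"
    proof (rule order_continuous_decreases[OF Spos conditional_expectation_continuous[OF S]
          truncation_decreases[OF e x]])
      fix d assume "d \<in> (\<lambda>t. x - inf x (t *\<^sub>R e)) ` {0..}"
      then obtain t where t: "0 \<le> t" and d: "d = x - inf x (t *\<^sub>R e)" by auto
      let ?y = "inf x (t *\<^sub>R e)"
      have d0: "0 \<le> d" by (simp add: d del: diff_inf_eq_sup)
      have "S (Q ?y) \<le> S (Q (t *\<^sub>R e))"
        by (intro positive_mono[OF Spos] order_projection_mono[OF Q]) simp
      also have "\<dots> = t *\<^sub>R Q e" by (simp add: order_projection_scale[OF Q] linear_scale[OF Slin] Qe)
      finally have "?C (S (Q ?y)) \<le> ?C (t *\<^sub>R Q e)" by (rule order_projection_mono[OF C])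
      also have "\<dots> = 0" by (simp add: order_projection_scale[OF Q] order_projection_idem[OF Q])
      finally have y0: "?C (S (Q ?y)) \<le> 0" .
      have "x = d + ?y" by (simp add: d del: diff_inf_eq_sup)
      then have "?C (S (Q x)) = ?C (S (Q d)) + ?C (S (Q ?y))"
        by (metis linear_add[OF Slin] order_projection_add[OF Q] order_projection_add[OF C])
      also have "\<dots> \<le> ?C (S (Q d))" using y0 by simp
      also have "\<dots> \<le> S (Q d)"
        by (rule order_projection_le[OF C]) (intro positive_nonneg[OF Spos] order_projection_nonneg[OF Q] d0)
      also have "\<dots> \<le> S d" by (intro positive_mono[OF Spos] order_projection_le[OF Q] d0)
      finally show "?C (S (Q x)) \<le> S d" .
    qed
    moreover have "0 \<le> ?C (S (Q x))"
      by (intro order_projection_nonneg[OF C] positive_nonneg[OF Spos] order_projection_nonneg[OF Q] x)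
    ultimately show ?thesis by simp
  qed
  have PeS: "S (P e) = P e" using Pe conditional_expectation_idem[OF S] by (metis rangeE)
  show ?thesis
  proof (rule eq_on_positive_cone[of "\<lambda>x. S (P x)" "\<lambda>x. P (S x)"])
    show "linear (\<lambda>x. S (P x))" "linear (\<lambda>x. P (S x))"
      using linear_compose[OF order_projection_linear[OF P] Slin]
        linear_compose[OF Slin order_projection_linear[OF P]] by (simp_all add: o_def)
    fix x :: 'a assume x: "0 \<le> x"
    \<comment> \<open>Using \<open>key\<close> for the complement as well shows that
      \<open>S\<close> keeps the two bands apart.\<close>
    have "S (x - P x) = S (x - P x) - P (S (x - P x))"
      by (rule key[OF order_projection_compl[OF P] _ x]) (simp add: linear_diff[OF Slin] PeS Se)
    then have "P (S (x - P x)) = 0" by simp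
    then have "P (S x) = P (S (P x))"
      by (simp add: linear_diff[OF Slin] order_projection_diff[OF P])
    then show "S (P x) = P (S x)" using key[OF P PeS x] by simp
  qed
qed

section \<open>The conditional expectation onto a closed Riesz subspace\<close>

locale cond_exp_space =
  fixes T :: "'a::dedekind_complete_riesz_space \<Rightarrow> 'a" and e :: 'a
  assumes CE: "conditional_expectation T"
    and SP: "strictly_positive T"
    and UC: "universally_complete T"
    and unit: "weak_order_unit e"
    and Te: "T e = e"
begin

lemma e_nonneg: "0 \<le> e"
  using unit by (simp add: weak_order_unit_def)

lemmas T_positive = conditional_expectation_positive[OF CE]
  and T_continuous = conditional_expectation_continuous[OF CE]
lemmas T_linear = positive_linear[OF T_positive]
lemmas T_mono = positive_mono[OF T_positive]
  and T_nonneg = positive_nonneg[OF T_positive]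
  and T_diff = linear_diff[OF T_linear]
  and T_add = linear_add[OF T_linear]
  and T_scale = linear_scale[OF T_linear]
  and T_0 = linear_0[OF T_linear]

lemma T_eq_0: "0 \<le> x \<Longrightarrow> T x \<le> 0 \<Longrightarrow> x = 0"
  using SP antisym[OF _ T_nonneg[of x]] unfolding strictly_positive_def by blast

text \<open>The events of \<open>F\<close>, each kept as a projection rather than as a component of
  \<open>e\<close>, because projections can be composed and applied to arbitrary elements.\<close>

definition projections :: "'a set \<Rightarrow> ('a \<Rightarrow> 'a) set" where
  "projections F = {P. order_projection P \<and> P e \<in> F}"

definition admissible :: "'a set \<Rightarrow> bool" where
  "admissible F \<longleftrightarrow> closed_riesz F \<and> range T \<subseteq> F"

lemma admissible_range: "admissible (range T)"
  by (simp add: admissible_def closed_riesz_range[OF CE])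

lemma projectionsD: "P \<in> projections F \<Longrightarrow> order_projection P"
  by (simp add: projections_def)

lemma projections_mono: "F \<subseteq> G \<Longrightarrow> projections F \<subseteq> projections G"
  by (auto simp: projections_def)

lemma T_average: "P \<in> projections (range T) \<Longrightarrow> T (P x) = P (T x)"
  unfolding projections_def by (intro averaging[OF CE unit Te]) auto

context
  fixes F assumes F: "admissible F"
begin

lemma admissible_riesz: "riesz_subspace F"
  and admissible_closed: "order_closed F"
  and admissible_closed_riesz: "closed_riesz F"
  and admissible_subspace: "subspace F"
  and admissible_T: "T x \<in> F"
  using F by (auto simp: admissible_def closed_riesz_def riesz_subspace_def)

lemma admissible_e: "e \<in> F"
  using admissible_T[of e] Te by simp

text \<open>\<open>P\<close> is the principal projection of \<open>P e\<close>, and so its values at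
  positive elements are order limits of meets with multiples of \<open>P e\<close>.\<close>

lemma projections_stable: "P \<in> projections F \<Longrightarrow> x \<in> F \<Longrightarrow> P x \<in> F"
  using closed_riesz_proj[OF admissible_closed_riesz, of "P e" x] order_projection_eq_proj[OF unit, of P]
    order_projection_nonneg[OF _ e_nonneg, of P] by (simp add: projections_def)

lemma projections_id: "(\<lambda>x. x) \<in> projections F"
  by (simp add: projections_def order_projection_id admissible_e)

lemma projections_compl: "P \<in> projections F \<Longrightarrow> (\<lambda>x. x - P x) \<in> projections F"
  by (simp add: projections_def order_projection_compl subspace_diff[OF admissible_subspace] admissible_e)

lemma projections_compose:
  "P \<in> projections F \<Longrightarrow> Q \<in> projections F \<Longrightarrow> (\<lambda>x. P (Q x)) \<in> projections F"
  using projections_stable[of P "Q e"] by (simp add: projections_def order_projection_compose)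

lemma projections_sum:
  "P \<in> projections F \<Longrightarrow> Q \<in> projections F \<Longrightarrow> (\<And>x. P (Q x) = 0) \<Longrightarrow> (\<lambda>x. P x + Q x) \<in> projections F"
  by (simp add: projections_def order_projection_sum subspace_add[OF admissible_subspace])

lemma projections_proj: "u \<in> F \<Longrightarrow> 0 \<le> u \<Longrightarrow> proj u \<in> projections F"
  by (simp add: projections_def order_projection_proj closed_riesz_proj[OF admissible_closed_riesz] admissible_e)

end

lemma proj_pprt: "proj (pprt x) x = pprt x"
proof -
  have "proj (pprt x) (pprt x - pprt (- x)) = pprt x"
    by (simp add: order_projection_diff[OF order_projection_proj] proj_self proj_disjoint
        inf_pprt inf_commute[of "pprt (- x)"] del: diff_inf_eq_sup)
  then show ?thesis by (simp only: pprt_diff)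
qed

text \<open>Test on the band where \<open>g\<close> exceeds \<open>h\<close>: its projection comes
  from \<open>F\<close> because \<open>g - h\<close> does, and strict positivity of \<open>T\<close>
  makes the excess vanish.\<close>

lemma admissible_le:
  assumes F: "admissible F" and g: "g \<in> F" "h \<in> F"
    and le: "\<And>P. P \<in> projections F \<Longrightarrow> T (P g) \<le> T (P h)"
  shows "g \<le> h"
proof -
  let ?u = "pprt (g - h)"
  have "?u \<in> F"
    by (intro riesz_subspace_pprt admissible_riesz[OF F] subspace_diff[OF admissible_subspace[OF F]] g)
  then have "proj ?u \<in> projections F" by (simp add: projections_proj[OF F])
  then have "T (proj ?u (g - h)) \<le> 0"
    using le by (simp add: order_projection_diff[OF order_projection_proj] T_diff)
  then have "?u = 0" by (intro T_eq_0) (simp_all add: proj_pprt)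
  then show ?thesis by (metis diff_le_0_iff_le le_zero_iff_zero_pprt)
qed

text \<open>Universal completeness enters here, with the chain itself as index set. The limit
  \<open>l\<close> is an upper bound that \<open>C\<close> approaches from below, so the maximality
  arguments can work with the decreasing family of the \<open>l - c\<close>.\<close>

lemma chain_limit:
  assumes "C \<noteq> {}" and chain: "\<And>x y. x \<in> C \<Longrightarrow> y \<in> C \<Longrightarrow> x \<le> y \<or> y \<le> x"
    and nn: "\<And>x. x \<in> C \<Longrightarrow> 0 \<le> x" and le: "\<And>x. x \<in> C \<Longrightarrow> T x \<le> b"
  obtains l where "decreases_to_zero ((\<lambda>c. l - c) ` C)"
proof -
  have "directed_preorder C (\<le>)"
    unfolding directed_preorder_def
    by (intro conjI ballI impI assms(1) order_refl) (metis order_trans, metis chain order_refl)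
  moreover have "(\<lambda>i. T i) ` C \<subseteq> {0..b}" using le nn T_nonneg by auto
  ultimately obtain l where l: "order_conv (\<lambda>x. x) l (tails C (\<le>))"
    using UC nn unfolding universally_complete_def by meson
  then obtain D where D: "decreases_to_zero D"
    "\<And>d. d \<in> D \<Longrightarrow> eventually (\<lambda>x. \<bar>x - l\<bar> \<le> d) (tails C (\<le>))"
    unfolding order_conv_def by auto
  have ev: "eventually Q (tails C (\<le>)) \<longleftrightarrow> (\<exists>c\<in>C. \<forall>x\<in>C. c \<le> x \<longrightarrow> Q x)" for Q
    unfolding tails_def
  proof (subst eventually_INF_base)
    fix a b assume "a \<in> C" "b \<in> C"
    then show "\<exists>x\<in>C. principal {j \<in> C. x \<le> j} \<le> inf (principal {j \<in> C. a \<le> j}) (principal {j \<in> C. b \<le> j})"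
      using chain[of a b] by (auto intro: order_trans)
  qed (use assms(1) in \<open>auto simp: eventually_principal\<close>)
  note tail = D(2)[unfolded ev]
  have upper: "c \<le> l" if c: "c \<in> C" for c
  proof -
    have "c - l \<le> 0"
    proof (rule decreases_to_zero_le[OF D(1)])
      fix d assume "d \<in> D"
      then obtain a where a: "a \<in> C" "\<And>x. x \<in> C \<Longrightarrow> a \<le> x \<Longrightarrow> \<bar>x - l\<bar> \<le> d" using tail by blast
      obtain x where x: "x \<in> C" "a \<le> x" "c \<le> x" using chain[OF a(1) c] a(1) c by auto
      have "c - l \<le> x - l" using x by simp
      also have "\<dots> \<le> d" using a(2)[OF x(1,2)] abs_ge_self order_trans by blast
      finally show "c - l \<le> d" .
    qed
    then show ?thesis by simp
  qed
  have "decreases_to_zero ((\<lambda>c. l - c) ` C)"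
  proof (rule decreases_to_zeroI)
    fix z assume z: "\<And>d. d \<in> (\<lambda>c. l - c) ` C \<Longrightarrow> z \<le> d"
    show "z \<le> 0"
    proof (rule decreases_to_zero_le[OF D(1)])
      fix d assume "d \<in> D"
      then obtain a where a: "a \<in> C" "\<And>x. x \<in> C \<Longrightarrow> a \<le> x \<Longrightarrow> \<bar>x - l\<bar> \<le> d" using tail by blast
      have "z \<le> l - a" using z a(1) by blast
      also have "\<dots> \<le> \<bar>a - l\<bar>" using abs_ge_minus_self[of "a - l"] by simp
      also have "\<dots> \<le> d" using a by simp
      finally show "z \<le> d" .
    qed
  next
    fix a b assume "a \<in> (\<lambda>c. l - c) ` C" "b \<in> (\<lambda>c. l - c) ` C"
    then obtain c c' where cc: "c \<in> C" "a = l - c" "c' \<in> C" "b = l - c'" by blast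
    then have "a \<le> b \<or> b \<le> a" using chain[of c c'] by auto
    then show "\<exists>x\<in>(\<lambda>c. l - c) ` C. x \<le> a \<and> x \<le> b"
      using \<open>a \<in> _\<close> \<open>b \<in> _\<close> by blast
  qed (use assms(1) upper in auto)
  then show ?thesis by (rule that)
qed

text \<open>Absolute continuity of the vector measure: components \<open>d\<close> decreasing to
  zero carry little of \<open>x\<close>. Truncating at level \<open>t\<close> leaves a remainder
  \<open>r\<close> with small \<open>T r\<close>, and the truncated part contributes at most
  \<open>t\<close> times \<open>T d\<close>.\<close>

lemma projection_T_small:
  assumes D: "decreases_to_zero D" and R: "\<And>d. d \<in> D \<Longrightarrow> order_projection (R d)"
    and Re: "\<And>d. d \<in> D \<Longrightarrow> R d e = d"
    and z: "\<And>d. d \<in> D \<Longrightarrow> z \<le> T (R d x)" and x: "0 \<le> x"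
  shows "z \<le> 0"
proof (rule order_continuous_decreases[OF T_positive T_continuous truncation_decreases[OF unit x]])
  fix r assume "r \<in> (\<lambda>t. x - inf x (t *\<^sub>R e)) ` {0..}"
  then obtain t where t: "0 \<le> t" and r: "r = x - inf x (t *\<^sub>R e)" by auto
  have r0: "0 \<le> r" by (simp add: r del: diff_inf_eq_sup)
  \<comment> \<open>Dividing by \<open>t + 1\<close> brings the bound to the form
    \<open>T d\<close>; \<open>t\<close> itself may be zero.\<close>
  have "(1 / (t + 1)) *\<^sub>R (z - T r) \<le> 0"
  proof (rule order_continuous_decreases[OF T_positive T_continuous D])
    fix d assume d: "d \<in> D"
    note Rd = R[OF d]
    have d0: "0 \<le> d" using D d by (rule decreases_to_zero_nonneg)
    have "x = r + inf x (t *\<^sub>R e)" by (simp add: r del: diff_inf_eq_sup)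
    then have "R d x = R d r + R d (inf x (t *\<^sub>R e))" by (metis order_projection_add[OF Rd])
    also have "\<dots> \<le> r + R d (t *\<^sub>R e)"
      by (intro add_mono order_projection_le[OF Rd r0] order_projection_mono[OF Rd]) simp
    also have "R d (t *\<^sub>R e) = t *\<^sub>R d" by (simp add: order_projection_scale[OF Rd] Re[OF d])
    also have "r + t *\<^sub>R d \<le> r + (t + 1) *\<^sub>R d" using d0 by (simp add: scaleR_add_left)
    finally have "T (R d x) \<le> T (r + (t + 1) *\<^sub>R d)" by (rule T_mono)
    then have "z \<le> T r + (t + 1) *\<^sub>R T d" using z[OF d] by (simp only: T_add T_scale)
    then have "z - T r \<le> (t + 1) *\<^sub>R T d" by (simp add: diff_le_eq add.commute)
    then have "(1 / (t + 1)) *\<^sub>R (z - T r) \<le> (1 / (t + 1)) *\<^sub>R ((t + 1) *\<^sub>R T d)"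
      using t by (intro scaleR_left_mono) auto
    also have "\<dots> = T d" using t by simp
    finally show "(1 / (t + 1)) *\<^sub>R (z - T r) \<le> T d" .
  qed
  then have "(t + 1) *\<^sub>R ((1 / (t + 1)) *\<^sub>R (z - T r)) \<le> (t + 1) *\<^sub>R 0"
    using t by (intro scaleR_left_mono) auto
  then show "z \<le> T r" using t by simp
qed

text \<open>Each \<open>c\<close> is disjoint from \<open>e - c\<close>, so comparing
  \<open>l\<close> with \<open>c\<close> bounds the meet of \<open>l\<close> and
  \<open>e - l\<close> by \<open>l - c\<close>. In the limit \<open>l\<close> is again a component
  of \<open>e\<close>.\<close>

lemma component_limit:
  assumes D: "decreases_to_zero ((\<lambda>c. l - c) ` C)" and l: "0 \<le> l" "l \<le> e"
    and C: "\<And>c. c \<in> C \<Longrightarrow> 0 \<le> c \<and> inf c (e - c) = 0"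
  shows "proj l e = l"
proof -
  have "inf (e - l) l \<le> 0"
  proof (rule decreases_to_zero_le[OF D])
    fix d assume "d \<in> (\<lambda>c. l - c) ` C"
    then obtain c where c: "c \<in> C" "d = l - c" by blast
    have d0: "0 \<le> d" using decreases_to_zero_nonneg[OF D, of d] c by blast
    have "inf (e - l) l \<le> inf (e - c) (c + d)"
      using d0 c(2) by (intro inf_mono) (simp_all add: algebra_simps)
    also have "\<dots> = inf (c + d) (e - c)" by (rule inf_commute)
    also have "\<dots> \<le> inf c (e - c) + inf d (e - c)"
    proof (rule inf_add_le)
      have "c \<le> l" using d0 c(2) by simp
      then show "0 \<le> e - c" using l(2) by (simp add: order_trans)
    qed (use C[OF c(1)] d0 in auto)
    also have "\<dots> \<le> d" using C[OF c(1)] by simp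
    finally show "inf (e - l) l \<le> d" .
  qed
  then have "inf (e - l) l = 0" using l by (intro antisym) simp_all
  then have "proj l (e - l) = 0" using l by (intro proj_disjoint) simp_all
  then show ?thesis by (simp add: order_projection_diff[OF order_projection_proj[OF l(1)]] proj_self l(1))
qed

lemma component_disjoint: "order_projection P \<Longrightarrow> inf (P e) (e - P e) = 0"
  using order_projection_disjoint[OF _ e_nonneg e_nonneg] .

lemma projection_absorb:
  assumes P: "order_projection P" and Q: "order_projection Q" and le: "Q e \<le> P e"
  shows "P (Q x) = Q x"
proof -
  have "P (Q e) = Q e"
    by (rule order_projection_fixed[OF P order_projection_nonneg[OF Q e_nonneg] le])
  then have "(\<lambda>x. P (Q x)) = Q"
    by (intro order_projection_eqI[OF unit order_projection_compose[OF P Q] Q])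
  then show ?thesis by metis
qed

section \<open>Hahn decomposition and Radon-Nikodym theorem for the vector measure\<close>

context
  fixes F assumes F: "admissible F"
begin

text \<open>Exhaustion: removing a maximal part of the projection on which the vector measure
  is nonpositive leaves a nonzero part on which it is positive, as in the Hahn decomposition.
  Negative parts can be localised because the range of \<open>T\<close> lies in \<open>F\<close>.\<close>

lemma positive_part_of_measure:
  assumes P1: "P1 \<in> projections F" and pos: "0 \<le> T (P1 h)" and nz: "T (P1 h) \<noteq> 0"
  obtains P where "P \<in> projections F" "P e \<noteq> 0" "\<And>Q. Q \<in> projections F \<Longrightarrow> 0 \<le> T (Q (P h))"
proof -
  note oP1 = projectionsD[OF P1]
  \<comment> \<open>Only the total value on \<open>Q\<close> has to be nonpositive, not the values
    on its parts; maximality alone will make the remainder positive on every part.\<close>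
  define A where "A = {q. \<exists>Q\<in>projections F. q = Q e \<and> q \<le> P1 e \<and> T (Q h) \<le> 0}"
  have P1e: "P1 e \<le> e" by (rule order_projection_le[OF oP1 e_nonneg])
  have zero: "(\<lambda>x. 0) \<in> projections F"
    by (simp add: projections_def order_projection_zero subspace_0[OF admissible_subspace[OF F]])
  obtain m where m: "m \<in> A" and max: "\<And>x. x \<in> A \<Longrightarrow> m \<le> x \<Longrightarrow> x = m"
  proof (rule order_zorn[of A])
    have "0 \<in> A" unfolding A_def using zero order_projection_nonneg[OF oP1 e_nonneg] by (auto simp: T_0)
    then show "A \<noteq> {}" by blast
    fix C assume CA: "C \<subseteq> A" and "C \<noteq> {}" and chain: "\<And>x y. x \<in> C \<Longrightarrow> y \<in> C \<Longrightarrow> x \<le> y \<or> y \<le> x"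
    have C: "\<exists>Q\<in>projections F. c = Q e \<and> c \<le> P1 e \<and> T (Q h) \<le> 0" if "c \<in> C" for c
      using that CA unfolding A_def by blast
    have C0: "0 \<le> c" if "c \<in> C" for c
      using C[OF that] order_projection_nonneg[OF projectionsD e_nonneg] by blast
    have "T c \<le> e" if "c \<in> C" for c
      using T_mono[of c e] Te C[OF that] P1e by (metis order_trans)
    then obtain l where D: "decreases_to_zero ((\<lambda>c. l - c) ` C)"
      using chain_limit[OF \<open>C \<noteq> {}\<close> chain C0] by blast
    have cl: "c \<le> l" if "c \<in> C" for c using decreases_to_zero_nonneg[OF D] that by fastforce
    have l0: "0 \<le> l" using cl C0 \<open>C \<noteq> {}\<close> by (meson ex_in_conv order_trans)
    have lP1: "l \<le> P1 e"
    proof -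
      have "l - P1 e \<le> 0"
        by (rule decreases_to_zero_le[OF D]) (use C in \<open>auto intro!: diff_left_mono\<close>)
      then show ?thesis by simp
    qed
    have lF: "l \<in> F"
    proof (rule order_closed_decreases[OF admissible_closed[OF F] D])
      fix d assume "d \<in> (\<lambda>c. l - c) ` C"
      then obtain c where c: "c \<in> C" "d = l - c" by blast
      then have "l - d = c" by simp
      then show "l - d \<in> F" using C[OF c(1)] by (auto simp: projections_def)
    qed
    have L: "proj l \<in> projections F" by (rule projections_proj[OF F lF l0])
    note oL = projectionsD[OF L]
    have Le: "proj l e = l"
    proof (rule component_limit[OF D l0])
      show "l \<le> e" using lP1 P1e by (rule order_trans)
      fix c assume "c \<in> C"
      then show "0 \<le> c \<and> inf c (e - c) = 0"
        using C[OF \<open>c \<in> C\<close>] C0 component_disjoint[OF projectionsD] by blast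
    qed
    \<comment> \<open>The family is indexed by \<open>d = l - c\<close>, so
      \<open>proj (l - d)\<close> is the projection \<open>Q\<close> of the chain member
      \<open>c\<close>, and the operator belonging to \<open>d\<close> is the part of
      \<open>proj l\<close> outside \<open>Q\<close>.\<close>
    have "T (proj l h) \<le> 0"
    proof (rule projection_T_small[OF D, where x = "\<bar>h\<bar>" and R = "\<lambda>d x. proj l (x - proj (l - d) x)"])
      fix d assume "d \<in> (\<lambda>c. l - c) ` C"
      then obtain c where c: "c \<in> C" "d = l - c" by blast
      then obtain Q where Q: "Q \<in> projections F" "c = Q e" "T (Q h) \<le> 0" using C by blast
      note oQ = projectionsD[OF Q(1)]
      have pc: "proj (l - d) = Q"
        using order_projection_eq_proj[OF unit oQ] Q(2) c(2) by simp
      show oR: "order_projection (\<lambda>x. proj l (x - proj (l - d) x))"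
        unfolding pc by (rule order_projection_compose[OF oL order_projection_compl[OF oQ]])
      have LQ: "proj l (Q x) = Q x" for x
        by (rule projection_absorb[OF oL oQ]) (use Le cl[OF c(1)] Q(2) in simp)
      show "proj l (e - proj (l - d) e) = d"
        unfolding pc by (simp add: order_projection_diff[OF oL] LQ Le c(2) Q(2))
      have "T (proj l h) = T (Q h) + T (proj l (h - Q h))"
        by (simp add: order_projection_diff[OF oL] LQ T_diff)
      also have "\<dots> \<le> T (proj l (h - Q h))" using Q(3) by simp
      also have "\<dots> \<le> T \<bar>proj l (h - Q h)\<bar>" by (intro T_mono abs_ge_self)
      also have "\<bar>proj l (h - Q h)\<bar> = proj l (\<bar>h\<bar> - Q \<bar>h\<bar>)"
        using order_projection_abs[OF oR] unfolding pc by simp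
      finally show "T (proj l h) \<le> T (proj l (\<bar>h\<bar> - proj (l - d) \<bar>h\<bar>))" unfolding pc .
    qed simp
    then have "l \<in> A" unfolding A_def using L Le lP1 by (intro CollectI bexI[OF _ L]) simp
    then show "\<exists>u\<in>A. \<forall>x\<in>C. x \<le> u" using cl by blast
  qed blast
  then obtain Q0 where Q0: "Q0 \<in> projections F" "m = Q0 e" "Q0 e \<le> P1 e" "T (Q0 h) \<le> 0"
    unfolding A_def by blast
  note oQ0 = projectionsD[OF Q0(1)]
  have P1Q0: "P1 (Q0 x) = Q0 x" for x by (rule projection_absorb[OF oP1 oQ0 Q0(3)])
  define P where "P = (\<lambda>x. P1 (x - Q0 x))"
  have P: "P \<in> projections F"
    unfolding P_def by (rule projections_compose[OF F P1 projections_compl[OF F Q0(1)]])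
  note oP = projectionsD[OF P]
  have PQ0: "P (Q0 x) = 0" for x
    by (simp add: P_def order_projection_idem[OF oQ0] order_projection_0[OF oP1])
  show ?thesis
  proof (rule that[OF P])
    show "P e \<noteq> 0"
    proof
      assume "P e = 0"
      then have "P = (\<lambda>x. 0)"
        by (intro order_projection_eqI[OF unit oP order_projection_zero]) simp
      then have "P h = 0" by metis
      then have "P1 h = Q0 h" by (simp add: P_def order_projection_diff[OF oP1] P1Q0)
      then have "T (P1 h) \<le> 0" using Q0(4) by simp
      then show False using pos nz antisym by blast
    qed
    fix Q assume Q: "Q \<in> projections F"
    note oQ = projectionsD[OF Q]
    define y where "y = T (Q (P h))"
    \<comment> \<open>\<open>R\<close> cuts down to where the vector \<open>y\<close> is negative.
      As it comes from \<open>range T\<close> it passes through \<open>T\<close>, so cutting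
      \<open>Q (P h)\<close> by \<open>R\<close> yields exactly the negative part of
      \<open>y\<close>.\<close>
    define R where "R = proj (pprt (- y))"
    have "y \<in> range T" by (simp add: y_def)
    then have "pprt (- y) \<in> range T"
      by (intro riesz_subspace_pprt[OF admissible_riesz[OF admissible_range]]
          subspace_neg[OF admissible_subspace[OF admissible_range]])
    then have RT: "R \<in> projections (range T)"
      unfolding R_def by (intro projections_proj[OF admissible_range]) simp_all
    then have RF: "R \<in> projections F"
      using projections_mono[of "range T" F] F by (auto simp: admissible_def)
    note oR = projectionsD[OF RF]
    define S where "S = (\<lambda>x. R (Q (P x)))"
    have S: "S \<in> projections F"
      unfolding S_def by (intro projections_compose[OF F RF] projections_compose[OF F Q] P)
    note oS = projectionsD[OF S]
    have "R y = - pprt (- y)"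
      using proj_pprt[of "- y"] unfolding R_def[symmetric] order_projection_neg[OF oR]
      by (metis minus_minus)
    then have TS: "T (S h) = - pprt (- y)" by (simp add: S_def T_average[OF RT] y_def)
    have SQ0: "S (Q0 x) = 0" for x
      by (simp add: S_def PQ0 order_projection_0[OF oQ] order_projection_0[OF oR])
    have Q0S: "Q0 (S x) = 0" for x using SQ0 order_projection_commute[OF oS oQ0] by metis
    \<comment> \<open>\<open>S\<close> is disjoint from \<open>Q0\<close> and stays below
      \<open>P1\<close>. Adding it keeps the total nonpositive, so maximality of \<open>m\<close>
      forces \<open>S = 0\<close> and thus \<open>0 \<le> y\<close>.\<close>
    have sum: "(\<lambda>x. Q0 x + S x) \<in> projections F" by (rule projections_sum[OF F Q0(1) S Q0S])
    have "P1 (S x) = S x" for x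
    proof -
      have "P1 (S x) = R (Q (P1 (P x)))"
        unfolding S_def by (metis order_projection_commute[OF oP1 oR] order_projection_commute[OF oP1 oQ])
      then show ?thesis by (simp add: S_def P_def order_projection_idem[OF oP1])
    qed
    then have "Q0 e + S e = P1 (Q0 e + S e)" by (simp add: order_projection_add[OF oP1] P1Q0)
    also have "\<dots> \<le> P1 e"
      by (intro order_projection_mono[OF oP1] order_projection_le[OF projectionsD[OF sum] e_nonneg])
    finally have "Q0 e + S e \<le> P1 e" .
    moreover have "T (Q0 h + S h) \<le> 0"
      unfolding T_add TS using Q0(4) by (simp add: add_nonpos_nonpos del: add_uminus_conv_diff)
    ultimately have "Q0 e + S e \<in> A"
      unfolding A_def by (intro CollectI bexI[OF _ sum]) simp
    then have "Q0 e + S e = m" by (rule max) (simp add: Q0(2) order_projection_nonneg[OF oS e_nonneg])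
    then have "S e = 0" by (simp add: Q0(2))
    then have "S = (\<lambda>x. 0)"
      by (intro order_projection_eqI[OF unit oS order_projection_zero]) simp
    then have "S h = 0" by metis
    then have "pprt (- y) = 0" using TS by (simp add: T_0)
    then have "- y \<le> 0" by (simp only: le_zero_iff_zero_pprt)
    then show "0 \<le> T (Q (P h))" by (simp add: y_def)
  qed
qed

text \<open>Exhaustion: \<open>g\<close> is maximal among the positive elements of \<open>F\<close>
  whose tests stay below those of \<open>f\<close>. If some test of the defect \<open>w\<close> were
  nonzero, a small multiple of \<open>e\<close> could be subtracted from \<open>w\<close> with a
  part of it staying positive, and \<open>g\<close> could be raised there.\<close>

lemma cond_exp_exists_nonneg:
  assumes f: "0 \<le> f"
  shows "\<exists>g\<in>F. \<forall>P\<in>projections F. T (P g) = T (P f)"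
proof -
  define A where "A = {g\<in>F. 0 \<le> g \<and> (\<forall>P\<in>projections F. T (P g) \<le> T (P f))}"
  obtain g where g: "g \<in> A" and max: "\<And>x. x \<in> A \<Longrightarrow> g \<le> x \<Longrightarrow> x = g"
  proof (rule order_zorn[of A])
    have "T (P 0) \<le> T (P f)" if "P \<in> projections F" for P
      by (intro T_mono order_projection_mono[OF projectionsD[OF that]] f)
    then have "0 \<in> A" by (simp add: A_def subspace_0[OF admissible_subspace[OF F]])
    then show "A \<noteq> {}" by blast
    fix C assume CA: "C \<subseteq> A" and "C \<noteq> {}" and chain: "\<And>x y. x \<in> C \<Longrightarrow> y \<in> C \<Longrightarrow> x \<le> y \<or> y \<le> x"
    have C0: "0 \<le> c" if "c \<in> C" for c using that CA by (auto simp: A_def)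
    have C1: "T (P c) \<le> T (P f)" if "c \<in> C" "P \<in> projections F" for c P
      using that CA by (auto simp: A_def)
    have "T c \<le> T f" if "c \<in> C" for c using C1[OF that projections_id[OF F]] .
    then obtain l where D: "decreases_to_zero ((\<lambda>c. l - c) ` C)"
      using chain_limit[OF \<open>C \<noteq> {}\<close> chain C0] by blast
    have cl: "c \<le> l" if "c \<in> C" for c using decreases_to_zero_nonneg[OF D] that by fastforce
    have l0: "0 \<le> l" using cl C0 \<open>C \<noteq> {}\<close> by (meson ex_in_conv order_trans)
    have lF: "l \<in> F"
    proof (rule order_closed_decreases[OF admissible_closed[OF F] D])
      fix d assume "d \<in> (\<lambda>c. l - c) ` C"
      then obtain c where c: "c \<in> C" "d = l - c" by blast
      then have "l - d = c" by simp
      then show "l - d \<in> F" using CA c(1) by (auto simp: A_def)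
    qed
    have "T (P l) \<le> T (P f)" if P: "P \<in> projections F" for P
    proof -
      note oP = projectionsD[OF P]
      have "T (P l) - T (P f) \<le> 0"
      proof (rule order_continuous_decreases[OF T_positive T_continuous D])
        fix d assume "d \<in> (\<lambda>c. l - c) ` C"
        then obtain c where c: "c \<in> C" "d = l - c" by blast
        have "T (P l) - T (P f) \<le> T (P l) - T (P c)" using C1[OF c(1) P] by simp
        also have "\<dots> = T (P d)" by (simp add: c(2) order_projection_diff[OF oP] T_diff)
        also have "\<dots> \<le> T d"
          using cl[OF c(1)] c(2) by (intro T_mono order_projection_le[OF oP]) simp
        finally show "T (P l) - T (P f) \<le> T d" .
      qed
      then show ?thesis by simp
    qed
    then have "l \<in> A" using lF l0 by (simp add: A_def)
    then show "\<exists>u\<in>A. \<forall>x\<in>C. x \<le> u" using cl by blast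
  qed blast
  have gF: "g \<in> F" and g0: "0 \<le> g" and gle: "\<And>P. P \<in> projections F \<Longrightarrow> T (P g) \<le> T (P f)"
    using g by (auto simp: A_def)
  define w where "w = f - g"
  have w: "0 \<le> T (P w)" if "P \<in> projections F" for P
    using gle[OF that] by (simp add: w_def order_projection_diff[OF projectionsD[OF that]] T_diff)
  have "T (P w) = 0" if P: "P \<in> projections F" for P
  proof (rule ccontr)
    assume nz: "T (P w) \<noteq> 0"
    note oP = projectionsD[OF P]
    \<comment> \<open>The Archimedean property yields the height \<open>\<epsilon>\<close> by which
      \<open>g\<close> will be raised.\<close>
    have "\<not> (\<forall>n. T (P w) \<le> (1/2)^n *\<^sub>R T (P e))"
      using archimedean[of "T (P e)" "T (P w)"] w[OF P] nz
        T_nonneg[OF order_projection_nonneg[OF oP e_nonneg]] by (meson antisym)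
    then obtain n where n: "\<not> T (P w) \<le> (1/2)^n *\<^sub>R T (P e)" by blast
    define \<epsilon> :: real where "\<epsilon> = (1/2)^n"
    have \<epsilon>: "0 < \<epsilon>" by (simp add: \<epsilon>_def)
    define h where "h = w - \<epsilon> *\<^sub>R e"
    define y where "y = T (P h)"
    have "\<not> y \<le> 0" using n
      by (simp add: y_def h_def \<epsilon>_def order_projection_diff[OF oP] order_projection_scale[OF oP] T_diff T_scale)
    then have y: "pprt y \<noteq> 0" by (simp add: le_zero_iff_zero_pprt)
    \<comment> \<open>That \<open>y\<close> is not at most zero does not make this vector positive.
      Cutting by \<open>R\<close> replaces it with \<open>pprt y\<close>, as
      \<open>positive_part_of_measure\<close> requires.\<close>
    define R where "R = proj (pprt y)"
    have "pprt y \<in> range T"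
      by (intro riesz_subspace_pprt[OF admissible_riesz[OF admissible_range]]) (simp add: y_def)
    then have RT: "R \<in> projections (range T)"
      unfolding R_def by (intro projections_proj[OF admissible_range]) simp_all
    then have RF: "R \<in> projections F"
      using projections_mono[of "range T" F] F by (auto simp: admissible_def)
    have TR: "T (R (P h)) = pprt y"
      using proj_pprt[of y] unfolding T_average[OF RT] y_def[symmetric] R_def[symmetric] .
    obtain P' where P': "P' \<in> projections F" "P' e \<noteq> 0"
      "\<And>Q. Q \<in> projections F \<Longrightarrow> 0 \<le> T (Q (P' h))"
      using positive_part_of_measure[OF projections_compose[OF F RF P], of h] TR y by auto
    note oP' = projectionsD[OF P'(1)]
    let ?g = "g + \<epsilon> *\<^sub>R P' e"
    have "?g \<in> A"
      unfolding A_def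
    proof (intro CollectI conjI ballI)
      have "P' e \<in> F" using P'(1) by (simp add: projections_def)
      then show "?g \<in> F"
        by (intro subspace_add[OF admissible_subspace[OF F]] subspace_scale[OF admissible_subspace[OF F]] gF)
      show "0 \<le> ?g" using g0 \<epsilon> order_projection_nonneg[OF oP' e_nonneg]
        by (intro add_nonneg_nonneg scaleR_nonneg_nonneg) auto
      fix Q assume Q: "Q \<in> projections F"
      note oQ = projectionsD[OF Q]
      \<comment> \<open>Inside \<open>P'\<close> the gain \<open>\<epsilon>\<close> is paid for by
        positivity of the measure of \<open>h\<close>; outside it \<open>g\<close> is unchanged and
        \<open>w\<close> has nonnegative tests.\<close>
      have "0 \<le> T (Q (P' h)) + T (Q (w - P' w))"
        using P'(3)[OF Q] w[OF projections_compose[OF F Q projections_compl[OF F P'(1)]]]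
        by (rule add_nonneg_nonneg)
      also have "\<dots> = T (Q f) - T (Q ?g)"
        by (simp add: h_def w_def order_projection_diff[OF oQ] order_projection_diff[OF oP'] order_projection_add[OF oQ]
            order_projection_scale[OF oQ] order_projection_scale[OF oP'] T_diff T_add T_scale)
      finally show "T (Q ?g) \<le> T (Q f)" by simp
    qed
    then have "?g = g"
      using \<epsilon> order_projection_nonneg[OF oP' e_nonneg] by (intro max) (auto intro: scaleR_nonneg_nonneg)
    then show False using \<epsilon> P'(2) by simp
  qed
  then have "T (P g) = T (P f)" if "P \<in> projections F" for P
    using that by (fastforce simp: w_def order_projection_diff[OF projectionsD] T_diff)
  then show ?thesis using gF by blast
qed

section \<open>The conditional expectation determined by its tests\<close>

lemma cond_exp_exists: "\<exists>!g. g \<in> F \<and> (\<forall>P\<in>projections F. T (P g) = T (P f))"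
proof -
  obtain g1 g2 where g: "g1 \<in> F" "\<And>P. P \<in> projections F \<Longrightarrow> T (P g1) = T (P (pprt f))"
    "g2 \<in> F" "\<And>P. P \<in> projections F \<Longrightarrow> T (P g2) = T (P (pprt (- f)))"
    using cond_exp_exists_nonneg[OF zero_le_pprt, of f] cond_exp_exists_nonneg[OF zero_le_pprt, of "- f"]
    by blast
  show ?thesis
  proof
    show "g1 - g2 \<in> F \<and> (\<forall>P\<in>projections F. T (P (g1 - g2)) = T (P f))"
    proof (intro conjI ballI subspace_diff[OF admissible_subspace[OF F]] g)
      fix P assume P: "P \<in> projections F"
      have "T (P (g1 - g2)) = T (P (pprt f - pprt (- f)))"
        by (simp add: order_projection_diff[OF projectionsD[OF P]] T_diff g P)
      then show "T (P (g1 - g2)) = T (P f)" by (simp only: pprt_diff)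
    qed
    then have h: "g1 - g2 \<in> F" "\<And>P. P \<in> projections F \<Longrightarrow> T (P (g1 - g2)) = T (P f)" by blast+
    fix g assume g: "g \<in> F \<and> (\<forall>P\<in>projections F. T (P g) = T (P f))"
    show "g = g1 - g2"
    proof (rule antisym)
      show "g \<le> g1 - g2" by (rule admissible_le[OF F]) (use g h in simp_all)
      show "g1 - g2 \<le> g" by (rule admissible_le[OF F]) (use g h in simp_all)
    qed
  qed
qed

definition cexp :: "'a \<Rightarrow> 'a" where
  "cexp f = (THE g. g \<in> F \<and> (\<forall>P\<in>projections F. T (P g) = T (P f)))"

lemma cexp_in: "cexp f \<in> F"
  and T_cexp: "P \<in> projections F \<Longrightarrow> T (P (cexp f)) = T (P f)"
  using theI'[OF cond_exp_exists[of f]] by (simp_all add: cexp_def)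

lemma cexp_eqI:
  "g \<in> F \<Longrightarrow> (\<And>P. P \<in> projections F \<Longrightarrow> T (P g) = T (P f)) \<Longrightarrow> cexp f = g"
  unfolding cexp_def by (rule the1_equality[OF cond_exp_exists]) blast

lemma cexp_linear: "linear cexp"
proof (rule linearI)
  show "cexp (x + y) = cexp x + cexp y" for x y
    by (rule cexp_eqI[OF subspace_add[OF admissible_subspace[OF F] cexp_in cexp_in]])
      (simp add: order_projection_add[OF projectionsD] T_add T_cexp)
  show "cexp (c *\<^sub>R x) = c *\<^sub>R cexp x" for c x
    by (rule cexp_eqI[OF subspace_scale[OF admissible_subspace[OF F] cexp_in]])
      (simp add: order_projection_scale[OF projectionsD] T_scale T_cexp)
qed

lemma cexp_positive: "positive cexp"
  unfolding positive_def
proof (intro conjI allI impI cexp_linear)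
  fix x :: 'a assume "0 \<le> x"
  then show "0 \<le> cexp x"
    by (intro admissible_le[OF F _ cexp_in] subspace_0[OF admissible_subspace[OF F]])
      (simp add: T_cexp order_projection_0[OF projectionsD] T_0 T_nonneg order_projection_nonneg[OF projectionsD])
qed

lemma cexp_fixed: "x \<in> F \<Longrightarrow> cexp x = x"
  by (rule cexp_eqI) auto

lemma cexp_T: "T (cexp x) = T x"
  using T_cexp[OF projections_id[OF F]] .

lemma range_cexp: "range cexp = F"
  using cexp_in cexp_fixed by (metis image_subset_iff rangeI subsetI subset_antisym)

lemma cexp_conditional_expectation: "conditional_expectation cexp"
  unfolding conditional_expectation_def
proof (intro conjI allI impI cexp_linear)
  show "0 \<le> cexp x" if "0 \<le> x" for x by (rule positive_nonneg[OF cexp_positive that])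
  show "cexp \<circ> cexp = cexp" by (simp add: fun_eq_iff cexp_fixed cexp_in)
  show "order_continuous cexp"
  proof (rule order_continuousI[OF cexp_positive decreases_to_zero_image[OF cexp_positive]])
    fix D and z :: 'a assume D: "decreases_to_zero D" and z: "\<And>d. d \<in> D \<Longrightarrow> z \<le> cexp d"
    \<comment> \<open>Order continuity is borrowed from \<open>T\<close>: \<open>T (cexp d)\<close>
      equals \<open>T d\<close>, and strict positivity leads back from \<open>T (pprt z)\<close> to
      \<open>z\<close>.\<close>
    have "T (pprt z) \<le> 0"
    proof (rule order_continuous_decreases[OF T_positive T_continuous D])
      fix d assume d: "d \<in> D"
      have "pprt z \<le> cexp d"
        unfolding pprt_def using z[OF d] positive_nonneg[OF cexp_positive decreases_to_zero_nonneg[OF D d]] by simp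
      then show "T (pprt z) \<le> T d" using T_mono cexp_T by metis
    qed
    then have "pprt z = 0" by (intro T_eq_0) simp_all
    then show "z \<le> 0" by (simp only: le_zero_iff_zero_pprt)
  qed
  show "dedekind_complete_subspace (range cexp)"
    unfolding range_cexp dedekind_complete_subspace_def
  proof (intro conjI allI impI admissible_riesz[OF F])
    fix A assume A: "A \<subseteq> F" "A \<noteq> {}" "\<exists>b\<in>F. \<forall>a\<in>A. a \<le> b"
    then have bdd: "bdd_above A" by (auto intro: bdd_aboveI)
    \<comment> \<open>Being monotone and the identity on \<open>F\<close>, \<open>cexp\<close> turns
      the ambient supremum into the least upper bound within \<open>F\<close>.\<close>
    show "\<exists>s\<in>F. (\<forall>a\<in>A. a \<le> s) \<and> (\<forall>b\<in>F. (\<forall>a\<in>A. a \<le> b) \<longrightarrow> s \<le> b)"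
    proof (intro bexI[of _ "cexp (Sup A)"] conjI ballI impI cexp_in)
      fix a assume a: "a \<in> A"
      then have "cexp a \<le> cexp (Sup A)" by (intro positive_mono[OF cexp_positive] cSup_upper bdd)
      then show "a \<le> cexp (Sup A)" using cexp_fixed A(1) a by (metis subsetD)
    next
      fix b assume b: "b \<in> F" "\<forall>a\<in>A. a \<le> b"
      then have "cexp (Sup A) \<le> cexp b"
        using A(2) by (intro positive_mono[OF cexp_positive] cSup_least) auto
      then show "cexp (Sup A) \<le> b" using cexp_fixed[OF b(1)] by simp
    qed
  qed
  fix u :: 'a assume u: "weak_order_unit u"
  then have u0: "0 \<le> u" by (simp add: weak_order_unit_def)
  let ?v = "cexp u"
  have v0: "0 \<le> ?v" by (rule positive_nonneg[OF cexp_positive u0])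
  show "weak_order_unit ?v"
    unfolding weak_order_unit_def
  proof (intro conjI v0 allI impI)
    fix x assume x: "inf ?v \<bar>x\<bar> = 0"
    \<comment> \<open>\<open>T (u - ?R u)\<close> does not change when \<open>u\<close> is replaced
      by \<open>cexp u\<close>, so it vanishes and \<open>u\<close> lies in the band of
      \<open>cexp u\<close>. What is disjoint from \<open>cexp u\<close> is then disjoint from
      \<open>u\<close>.\<close>
    let ?R = "proj ?v"
    have R: "?R \<in> projections F" by (rule projections_proj[OF F cexp_in v0])
    note oR = projectionsD[OF R]
    have "T (u - ?R u) = T (cexp u - ?R (cexp u))" by (rule T_cexp[OF projections_compl[OF F R], symmetric])
    also have "\<dots> = 0" by (simp add: proj_self v0 T_0)
    finally have "u - ?R u = 0"
      using order_projection_le[OF oR u0] by (intro T_eq_0) simp_all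
    then have uR: "?R u = u" by simp
    have "?R \<bar>x\<bar> = 0" using x by (intro proj_disjoint v0) (simp_all add: inf_commute)
    moreover have "inf (?R u) (\<bar>x\<bar> - ?R \<bar>x\<bar>) = 0"
      by (rule order_projection_disjoint[OF oR u0]) simp
    ultimately have "inf u \<bar>x\<bar> = 0" using uR by simp
    then show "x = 0" using u by (simp add: weak_order_unit_def)
  qed
qed

text \<open>Uniqueness reduces to averaging: a competitor \<open>S\<close> with the same range
  commutes with each \<open>P\<close> in \<open>projections F\<close>, so \<open>T (P (S f))\<close>
  is \<open>T (S (P f))\<close>, which is \<open>T (P f)\<close>.\<close>

lemma cond_exp_onto_eq: "cond_exp_onto T F = cexp"
  unfolding cond_exp_onto_def
proof (rule the_equality)
  show "conditional_expectation cexp \<and> range cexp = F \<and> T \<circ> cexp = T \<and> cexp \<circ> T = T"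
    by (simp add: cexp_conditional_expectation range_cexp fun_eq_iff cexp_T cexp_fixed admissible_T[OF F])
  fix S assume S: "conditional_expectation S \<and> range S = F \<and> T \<circ> S = T \<and> S \<circ> T = T"
  then have Se: "S e = e" using Te by (metis comp_apply)
  show "S = cexp"
  proof (intro ext cexp_eqI[symmetric])
    show "S f \<in> F" for f using S by blast
    fix f P assume P: "P \<in> projections F"
    have "S (P f) = P (S f)"
      by (rule averaging[OF _ unit, where S = S]) (use S Se P in \<open>auto simp: projections_def\<close>)
    then show "T (P (S f)) = T (P f)" using S by (metis comp_apply)
  qed
qed

end

lemma cexp_average: "admissible F \<Longrightarrow> P \<in> projections F \<Longrightarrow> cexp F (P x) = P (cexp F x)"
  using averaging[OF cexp_conditional_expectation unit cexp_fixed[OF _ admissible_e], of F P x]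
  by (simp add: projections_def range_cexp)

lemma cexp_tower:
  assumes F: "admissible F" and G: "admissible G" and "F \<subseteq> G"
  shows "cexp F (cexp G x) = cexp F x"
proof (rule cexp_eqI[OF F cexp_in[OF F]])
  fix P assume P: "P \<in> projections F"
  then have "P \<in> projections G" using projections_mono[OF \<open>F \<subseteq> G\<close>] by blast
  then show "T (P (cexp F x)) = T (P (cexp G x))" by (simp add: T_cexp[OF F P] T_cexp[OF G])
qed

lemma cexp_abs_le:
  assumes F: "admissible F" and x: "\<bar>x\<bar> \<le> t *\<^sub>R e"
  shows "\<bar>cexp F x\<bar> \<le> t *\<^sub>R e"
proof -
  have "\<bar>cexp F x\<bar> \<le> cexp F \<bar>x\<bar>" by (rule positive_abs_le[OF cexp_positive[OF F]])
  also have "\<dots> \<le> cexp F (t *\<^sub>R e)" by (rule positive_mono[OF cexp_positive[OF F] x])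
  also have "\<dots> = t *\<^sub>R e"
    by (simp add: linear_scale[OF cexp_linear[OF F]] cexp_fixed[OF F admissible_e[OF F]])
  finally show ?thesis .
qed

lemma cexp_interval:
  assumes F: "admissible F" and x: "0 \<le> x" "x \<le> e"
  shows "0 \<le> cexp F x" "cexp F x \<le> e"
  using positive_nonneg[OF cexp_positive[OF F] x(1)] positive_mono[OF cexp_positive[OF F] x(2)]
  by (simp_all add: cexp_fixed[OF F admissible_e[OF F]])

subsection \<open>Approximation by components\<close>

text \<open>A dyadic form of Freudenthal's theorem: with \<open>P\<close> the projection onto the band where
  \<open>2 y \<ge> e\<close>, the element \<open>2 y - P e\<close> lies between \<open>0\<close> and \<open>e\<close> again.\<close>

lemma dyadic_approximation:
  assumes F: "admissible F" and K: "subspace K" and PK: "\<And>P. P \<in> projections F \<Longrightarrow> P e \<in> K"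
  shows "y \<in> F \<Longrightarrow> 0 \<le> y \<Longrightarrow> y \<le> e \<Longrightarrow> \<exists>x\<in>K. \<bar>y - x\<bar> \<le> (1/2) ^ n *\<^sub>R e"
proof (induction n arbitrary: y)
  case 0
  then show ?case using subspace_0[OF K] by (intro bexI[of _ 0]) (simp_all add: abs_of_nonneg)
next
  case (Suc n)
  define z where "z = 2 *\<^sub>R y - e"
  define P where "P = proj (pprt z)"
  have zF: "z \<in> F" unfolding z_def
    by (intro subspace_diff subspace_scale admissible_subspace[OF F] Suc.prems admissible_e[OF F])
  then have P: "P \<in> projections F"
    unfolding P_def by (intro projections_proj[OF F] riesz_subspace_pprt[OF admissible_riesz[OF F]]) simp_all
  note oP = projectionsD[OF P]
  have Pz: "P z = pprt z" by (simp add: P_def proj_pprt)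
  have ze: "z \<le> e" using add_mono[OF Suc.prems(3) Suc.prems(3)] by (simp add: z_def scaleR_2 diff_le_eq)
  let ?C = "\<lambda>x. x - P x"
  \<comment> \<open>\<open>P e\<close> is the leading binary digit of \<open>y\<close> and
    \<open>?y\<close> the shifted remainder; \<open>y\<close> is half of their sum, which halves the
    error of an approximation to \<open>?y\<close>.\<close>
  let ?y = "2 *\<^sub>R y - P e"
  have y': "?y = P z + ?C (2 *\<^sub>R y)"
    by (simp add: z_def order_projection_diff[OF oP])
  have "0 \<le> ?y"
    unfolding y' Pz using Suc.prems(2)
    by (intro add_nonneg_nonneg order_projection_nonneg[OF order_projection_compl[OF oP]])
      (simp_all add: scaleR_nonneg_nonneg)
  moreover have "?y \<le> e"
  proof -
    have "z - pprt z \<le> 0" by (simp add: pprt_def del: diff_sup_eq_inf)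
    then have "?C (2 *\<^sub>R y) \<le> ?C e"
      using Pz by (simp add: z_def order_projection_diff[OF oP] algebra_simps)
    moreover have "P z \<le> P e" by (rule order_projection_mono[OF oP ze])
    ultimately have "P z + ?C (2 *\<^sub>R y) \<le> P e + ?C e" by (rule add_mono[rotated])
    then show ?thesis unfolding y' by simp
  qed
  moreover have "?y \<in> F"
    by (intro subspace_diff subspace_scale admissible_subspace[OF F] Suc.prems projections_stable[OF F P] admissible_e[OF F])
  ultimately obtain x where x: "x \<in> K" "\<bar>?y - x\<bar> \<le> (1/2) ^ n *\<^sub>R e" using Suc.IH by blast
  have "y - (1/2) *\<^sub>R (P e + x) = (1/2) *\<^sub>R (?y - x)" by (simp add: algebra_simps)
  then have "\<bar>y - (1/2) *\<^sub>R (P e + x)\<bar> = (1/2) *\<^sub>R \<bar>?y - x\<bar>" by (simp only: abs_scaleR) simp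
  also have "\<dots> \<le> (1/2) *\<^sub>R ((1/2) ^ n *\<^sub>R e)" using x(2) by (intro scaleR_left_mono) auto
  finally show ?case
    by (intro bexI[of _ "(1/2) *\<^sub>R (P e + x)"] subspace_scale[OF K] subspace_add[OF K] PK P x(1)) simp
qed

lemma dyadic_decreases: "decreases_to_zero (range (\<lambda>n. (1/2) ^ n *\<^sub>R e))"
proof (rule decreases_to_zeroI)
  fix a b assume "a \<in> range (\<lambda>n. (1/2) ^ n *\<^sub>R e)" "b \<in> range (\<lambda>n. (1/2) ^ n *\<^sub>R e)"
  then obtain m n where mn: "a = (1/2) ^ m *\<^sub>R e" "b = (1/2) ^ n *\<^sub>R e" by blast
  have "(1/2) ^ max m n *\<^sub>R e \<le> a \<and> (1/2) ^ max m n *\<^sub>R e \<le> b"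
    unfolding mn by (intro conjI scaleR_right_mono e_nonneg power_decreasing) auto
  then show "\<exists>c\<in>range (\<lambda>n. (1/2) ^ n *\<^sub>R e). c \<le> a \<and> c \<le> b" by blast
next
  fix z assume "\<And>d. d \<in> range (\<lambda>n. (1/2) ^ n *\<^sub>R e) \<Longrightarrow> z \<le> d"
  then show "z \<le> 0" by (intro archimedean[OF e_nonneg]) blast
qed (auto intro: scaleR_nonneg_nonneg e_nonneg)

text \<open>Uniform dyadic approximation covers the elements between zero and \<open>e\<close>;
  scaling, truncation and differences do the rest. \<open>K\<close> is a mere subspace because the
  intended sets, on which two conditional expectations agree, need not be sublattices.\<close>

lemma components_generate:
  assumes F: "admissible F" and K: "subspace K" "order_closed K"
    and PK: "\<And>P. P \<in> projections F \<Longrightarrow> P e \<in> K"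
  shows "F \<subseteq> K"
proof -
  have unit_int: "y \<in> K" if y: "y \<in> F" "0 \<le> y" "y \<le> e" for y
  proof -
    obtain x where x: "\<And>n. x n \<in> K" "\<And>n. \<bar>y - x n\<bar> \<le> (1/2) ^ n *\<^sub>R e"
      using dyadic_approximation[OF F K(1) _ y] PK by metis
    have "order_conv (\<lambda>x. x) y (filtermap x sequentially)"
      unfolding order_conv_def eventually_filtermap
    proof (intro exI[of _ "range (\<lambda>n. (1/2) ^ n *\<^sub>R e)"] conjI ballI dyadic_decreases)
      fix d assume "d \<in> range (\<lambda>n. (1/2) ^ n *\<^sub>R e)"
      then obtain n where n: "d = (1/2) ^ n *\<^sub>R e" by blast
      have "\<bar>x m - y\<bar> \<le> d" if "n \<le> m" for m
      proof -
        have "\<bar>x m - y\<bar> \<le> (1/2) ^ m *\<^sub>R e" using x(2)[of m] by (simp add: abs_minus_commute)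
        also have "\<dots> \<le> (1/2) ^ n *\<^sub>R e"
          by (intro scaleR_right_mono e_nonneg power_decreasing that) auto
        finally show ?thesis by (simp add: n)
      qed
      then show "eventually (\<lambda>m. \<bar>x m - y\<bar> \<le> d) sequentially" by (rule eventually_sequentiallyI)
    qed
    moreover have "filtermap x sequentially \<noteq> bot" by (simp add: filtermap_bot_iff)
    moreover have "eventually (\<lambda>x. x \<in> K) (filtermap x sequentially)"
      using x(1) by (simp add: eventually_filtermap)
    ultimately show ?thesis using K(2) unfolding order_closed_def by blast
  qed
  have bdd: "y \<in> K" if y: "y \<in> F" "0 \<le> y" "y \<le> t *\<^sub>R e" and t: "0 \<le> t" for y t
  proof -
    have "(1 / (t + 1)) *\<^sub>R y \<le> (1 / (t + 1)) *\<^sub>R ((t + 1) *\<^sub>R e)"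
    proof (rule scaleR_left_mono)
      show "y \<le> (t + 1) *\<^sub>R e" using y(3) e_nonneg by (simp add: scaleR_add_left add_increasing2)
    qed (use t in simp)
    then have "(1 / (t + 1)) *\<^sub>R y \<in> K"
      using t y by (intro unit_int subspace_scale[OF admissible_subspace[OF F]]) (auto intro: scaleR_nonneg_nonneg)
    then have "(t + 1) *\<^sub>R ((1 / (t + 1)) *\<^sub>R y) \<in> K" by (rule subspace_scale[OF K(1)])
    then show ?thesis using t by simp
  qed
  have pos: "y \<in> K" if y: "y \<in> F" "0 \<le> y" for y
  proof (rule order_closed_decreases[OF K(2) truncation_decreases[OF unit y(2)]])
    fix d assume "d \<in> (\<lambda>t. y - inf y (t *\<^sub>R e)) ` {0..}"
    then obtain t where t: "0 \<le> t" "d = y - inf y (t *\<^sub>R e)" by auto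
    have "inf y (t *\<^sub>R e) \<in> K"
    proof (rule bdd[OF _ _ inf.cobounded2 t(1)])
      show "inf y (t *\<^sub>R e) \<in> F"
        by (intro riesz_subspace_inf[OF admissible_riesz[OF F]] y subspace_scale[OF admissible_subspace[OF F]] admissible_e[OF F])
      show "0 \<le> inf y (t *\<^sub>R e)" using y(2) t(1) e_nonneg by (simp add: scaleR_nonneg_nonneg)
    qed
    moreover have "y - d = inf y (t *\<^sub>R e)" by (simp add: t(2) del: diff_inf_eq_sup)
    ultimately show "y - d \<in> K" by simp
  qed
  show ?thesis
  proof
    fix y assume y: "y \<in> F"
    have "pprt y - pprt (- y) \<in> K"
      by (intro subspace_diff[OF K(1)] pos riesz_subspace_pprt[OF admissible_riesz[OF F]]
          subspace_neg[OF admissible_subspace[OF F]] y) simp_all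
    then show "y \<in> K" by (simp only: pprt_diff)
  qed
qed

text \<open>The closure for the vector-valued seminorm \<open>T \<bar>x\<bar>\<close> is order closed after a single step,
  unlike the set of order limits.\<close>

definition T_closure :: "'a set \<Rightarrow> 'a set" where
  "T_closure M = {x. \<forall>z. (\<forall>y\<in>M. z \<le> T \<bar>x - y\<bar>) \<longrightarrow> z \<le> 0}"

lemma T_closureD: "x \<in> T_closure M \<Longrightarrow> (\<And>y. y \<in> M \<Longrightarrow> z \<le> T \<bar>x - y\<bar>) \<Longrightarrow> z \<le> 0"
  by (auto simp: T_closure_def)

lemma T_closure_superset: "M \<subseteq> T_closure M"
  by (force simp: T_closure_def T_0)

text \<open>Everything is phrased through lower bounds \<open>z\<close> of distances. For a sum the
  two closure conditions are used in succession, the inner one with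
  \<open>z - T \<bar>x - y\<bar>\<close>. An order limit within \<open>d\<close> shifts the
  distances by at most \<open>T d\<close>, which is negligible by order continuity.\<close>

lemma T_closure_closed_riesz:
  assumes M: "riesz_subspace M"
  shows "closed_riesz (T_closure M)"
  unfolding closed_riesz_def
proof
  note sM = riesz_subspace_subspace[OF M]
  show "riesz_subspace (T_closure M)"
  proof (rule riesz_subspaceI)
    show "subspace (T_closure M)"
      unfolding subspace_def
    proof (intro conjI ballI allI)
      show "0 \<in> T_closure M" using T_closure_superset subspace_0[OF sM] by blast
    next
      fix x x' assume x: "x \<in> T_closure M" and x': "x' \<in> T_closure M"
      show "x + x' \<in> T_closure M"
        unfolding T_closure_def
      proof (intro CollectI allI impI)
        fix z assume z: "\<forall>y\<in>M. z \<le> T \<bar>x + x' - y\<bar>"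
        show "z \<le> 0"
        proof (rule T_closureD[OF x])
          fix y assume y: "y \<in> M"
          have "z - T \<bar>x - y\<bar> \<le> 0"
          proof (rule T_closureD[OF x'])
            fix y' assume y': "y' \<in> M"
            have "z \<le> T \<bar>x + x' - (y + y')\<bar>" using z subspace_add[OF sM y y'] by blast
            also have "\<dots> \<le> T (\<bar>x - y\<bar> + \<bar>x' - y'\<bar>)"
              using abs_triangle_ineq[of "x - y" "x' - y'"] by (intro T_mono) (simp add: algebra_simps)
            finally show "z - T \<bar>x - y\<bar> \<le> T \<bar>x' - y'\<bar>" by (simp add: T_add algebra_simps)
          qed
          then show "z \<le> T \<bar>x - y\<bar>" by simp
        qed
      qed
    next
      fix c :: real and x assume x: "x \<in> T_closure M"
      show "c *\<^sub>R x \<in> T_closure M"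
      proof (cases "c = 0")
        case True
        then show ?thesis using T_closure_superset subspace_0[OF sM] by auto
      next
        case False
        show ?thesis
          unfolding T_closure_def
        proof (intro CollectI allI impI)
          fix z assume z: "\<forall>y\<in>M. z \<le> T \<bar>c *\<^sub>R x - y\<bar>"
          have "(1 / \<bar>c\<bar>) *\<^sub>R z \<le> 0"
          proof (rule T_closureD[OF x])
            fix y assume y: "y \<in> M"
            have "z \<le> T \<bar>c *\<^sub>R x - c *\<^sub>R y\<bar>" using z subspace_scale[OF sM y] by blast
            also have "c *\<^sub>R x - c *\<^sub>R y = c *\<^sub>R (x - y)" by (simp add: scaleR_diff_right)
            also have "T \<bar>c *\<^sub>R (x - y)\<bar> = \<bar>c\<bar> *\<^sub>R T \<bar>x - y\<bar>" by (simp only: abs_scaleR T_scale)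
            finally have "(1 / \<bar>c\<bar>) *\<^sub>R z \<le> (1 / \<bar>c\<bar>) *\<^sub>R (\<bar>c\<bar> *\<^sub>R T \<bar>x - y\<bar>)"
              by (rule scaleR_left_mono) simp
            then show "(1 / \<bar>c\<bar>) *\<^sub>R z \<le> T \<bar>x - y\<bar>" using False by simp
          qed
          then have "\<bar>c\<bar> *\<^sub>R ((1 / \<bar>c\<bar>) *\<^sub>R z) \<le> \<bar>c\<bar> *\<^sub>R 0" by (rule scaleR_left_mono) simp
          then show "z \<le> 0" using False by simp
        qed
      qed
    qed
    fix x assume x: "x \<in> T_closure M"
    show "\<bar>x\<bar> \<in> T_closure M"
      unfolding T_closure_def
    proof (intro CollectI allI impI)
      fix z assume z: "\<forall>y\<in>M. z \<le> T \<bar>\<bar>x\<bar> - y\<bar>"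
      show "z \<le> 0"
      proof (rule T_closureD[OF x])
        fix y assume "y \<in> M"
        then have "\<bar>y\<bar> \<in> M" unfolding abs_lattice by (intro riesz_subspace_sup[OF M] subspace_neg[OF sM])
        then have "z \<le> T \<bar>\<bar>x\<bar> - \<bar>y\<bar>\<bar>" using z by blast
        also have "\<dots> \<le> T \<bar>x - y\<bar>" by (intro T_mono abs_triangle_ineq3)
        finally show "z \<le> T \<bar>x - y\<bar>" .
      qed
    qed
  qed
  show "order_closed (T_closure M)"
    unfolding order_closed_def
  proof (intro allI impI)
    fix F :: "'a filter" and l
    assume F: "F \<noteq> bot" and ev: "eventually (\<lambda>x. x \<in> T_closure M) F" and c: "order_conv (\<lambda>x. x) l F"
    then obtain D where D: "decreases_to_zero D" "\<And>d. d \<in> D \<Longrightarrow> eventually (\<lambda>x. \<bar>x - l\<bar> \<le> d) F"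
      unfolding order_conv_def by auto
    show "l \<in> T_closure M"
      unfolding T_closure_def
    proof (intro CollectI allI impI)
      fix z assume z: "\<forall>y\<in>M. z \<le> T \<bar>l - y\<bar>"
      show "z \<le> 0"
      proof (rule order_continuous_decreases[OF T_positive T_continuous D(1)])
        fix d assume "d \<in> D"
        have "eventually (\<lambda>x. z \<le> T d) F"
          using ev D(2)[OF \<open>d \<in> D\<close>]
        proof eventually_elim
          case (elim x)
          have "z - T d \<le> 0"
          proof (rule T_closureD[OF elim(1)])
            fix y assume "y \<in> M"
            then have "z \<le> T \<bar>l - y\<bar>" using z by blast
            also have "\<bar>l - y\<bar> \<le> \<bar>l - x\<bar> + \<bar>x - y\<bar>" using abs_triangle_ineq[of "l - x" "x - y"] by simp
            then have "T \<bar>l - y\<bar> \<le> T (d + \<bar>x - y\<bar>)"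
              using elim(2) by (intro T_mono) (metis abs_minus_commute add_right_mono order_trans)
            finally show "z - T d \<le> T \<bar>x - y\<bar>" by (simp add: T_add algebra_simps)
          qed
          then show ?case by simp
        qed
        then show "z \<le> T d" using F eventually_happens by fastforce
      qed
    qed
  qed
qed

end

subsection \<open>Simple operators\<close>

text \<open>Decision trees over a set of projections; their values at \<open>e\<close> play the role of simple
  functions, and the operators themselves that of multiplication by them.\<close>

inductive_set simple_ops :: "('a::real_vector \<Rightarrow> 'a) set \<Rightarrow> ('a \<Rightarrow> 'a) set"
  for \<A> :: "('a \<Rightarrow> 'a) set" where
  const: "(\<lambda>x. c *\<^sub>R x) \<in> simple_ops \<A>"
| split: "P \<in> \<A> \<Longrightarrow> A \<in> simple_ops \<A> \<Longrightarrow> B \<in> simple_ops \<A> \<Longrightarrow>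
    (\<lambda>x. P (A x) + (B x - P (B x))) \<in> simple_ops \<A>"

lemma order_projection_split_mono:
  assumes P: "order_projection P" and "\<bar>a\<bar> \<le> \<bar>a'\<bar>" "\<bar>b\<bar> \<le> \<bar>b'\<bar>"
  shows "\<bar>P a + (b - P b)\<bar> \<le> \<bar>P a' + (b' - P b')\<bar>"
  unfolding order_projection_split_abs[OF P]
  using order_projection_mono[OF P assms(2)] order_projection_mono[OF order_projection_compl[OF P] assms(3)]
  by (rule add_mono)

context
  fixes \<A> :: "('a::riesz_space \<Rightarrow> 'a) set"
  assumes \<A>: "\<And>P. P \<in> \<A> \<Longrightarrow> order_projection P"
begin

lemma simple_ops_linear: "A \<in> simple_ops \<A> \<Longrightarrow> linear A"
proof (induction rule: simple_ops.induct)
  case (const c)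
  show ?case by (rule linear_scale_self)
next
  case (split P A B)
  note P = order_projection_linear[OF \<A>[OF split.hyps(1)]]
  show ?case
    using linear_compose[OF split.IH(1) P] linear_compose[OF split.IH(2) P] split.IH
    by (intro linear_compose_add linear_compose_sub) (simp_all add: o_def)
qed

lemma simple_ops_add_const: "B \<in> simple_ops \<A> \<Longrightarrow> (\<lambda>x. c *\<^sub>R x + B x) \<in> simple_ops \<A>"
proof (induction rule: simple_ops.induct)
  case (const d)
  show ?case unfolding scaleR_add_left[symmetric] by (rule simple_ops.const)
next
  case (split P A B)
  have "(\<lambda>x. c *\<^sub>R x + (P (A x) + (B x - P (B x)))) =
      (\<lambda>x. P (c *\<^sub>R x + A x) + ((c *\<^sub>R x + B x) - P (c *\<^sub>R x + B x)))"
    by (simp add: fun_eq_iff order_projection_add[OF \<A>[OF split.hyps(1)]])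
  then show ?case using simple_ops.split[OF split.hyps(1) split.IH] by simp
qed

lemma simple_ops_add:
  "A \<in> simple_ops \<A> \<Longrightarrow> C \<in> simple_ops \<A> \<Longrightarrow> (\<lambda>x. A x + C x) \<in> simple_ops \<A>"
proof (induction rule: simple_ops.induct)
  case (const c)
  then show ?case by (rule simple_ops_add_const)
next
  case (split P A B)
  have "(\<lambda>x. (P (A x) + (B x - P (B x))) + C x) =
      (\<lambda>x. P (A x + C x) + ((B x + C x) - P (B x + C x)))"
    by (simp add: fun_eq_iff order_projection_add[OF \<A>[OF split.hyps(1)]])
  then show ?case using simple_ops.split[OF split.hyps(1) split.IH] split.prems by simp
qed

lemma simple_ops_scale: "A \<in> simple_ops \<A> \<Longrightarrow> (\<lambda>x. c *\<^sub>R A x) \<in> simple_ops \<A>"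
proof (induction rule: simple_ops.induct)
  case (const d)
  show ?case unfolding scaleR_scaleR by (rule simple_ops.const)
next
  case (split P A B)
  have "(\<lambda>x. c *\<^sub>R (P (A x) + (B x - P (B x)))) =
      (\<lambda>x. P (c *\<^sub>R A x) + (c *\<^sub>R B x - P (c *\<^sub>R B x)))"
    by (simp add: fun_eq_iff order_projection_scale[OF \<A>[OF split.hyps(1)]] algebra_simps)
  then show ?case using simple_ops.split[OF split.hyps(1) split.IH] by simp
qed

lemma simple_ops_projection: "P \<in> \<A> \<Longrightarrow> P \<in> simple_ops \<A>"
  using simple_ops.split[of P \<A> "\<lambda>x. 1 *\<^sub>R x" "\<lambda>x. 0 *\<^sub>R x", OF _ simple_ops.const simple_ops.const]
  by (simp add: order_projection_0[OF \<A>])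

text \<open>Put absolute values at the leaves of the tree; the branches live on disjoint
  bands.\<close>

lemma simple_ops_abs: "A \<in> simple_ops \<A> \<Longrightarrow> \<exists>B\<in>simple_ops \<A>. \<forall>x. \<bar>A x\<bar> = B \<bar>x\<bar>"
proof (induction rule: simple_ops.induct)
  case (const c)
  show ?case by (rule bexI[OF _ simple_ops.const[of "\<bar>c\<bar>"]]) (simp add: abs_scaleR)
next
  case (split P A B)
  then obtain A' B' where *: "A' \<in> simple_ops \<A>" "\<forall>x. \<bar>A x\<bar> = A' \<bar>x\<bar>"
    "B' \<in> simple_ops \<A>" "\<forall>x. \<bar>B x\<bar> = B' \<bar>x\<bar>" by blast
  show ?case
    by (rule bexI[OF _ simple_ops.split[OF split.hyps(1) *(1,3)]])
      (simp add: order_projection_split_abs[OF \<A>[OF split.hyps(1)]] *(2,4))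
qed

lemma simple_ops_abs_le:
  assumes A: "A \<in> simple_ops \<A>" and le: "\<bar>x\<bar> \<le> t *\<^sub>R y" and y: "0 \<le> y"
  shows "\<bar>A x\<bar> \<le> t *\<^sub>R \<bar>A y\<bar>"
proof -
  obtain B where B: "B \<in> simple_ops \<A>" "\<And>x. \<bar>A x\<bar> = B \<bar>x\<bar>" using simple_ops_abs[OF A] by blast
  have "0 \<le> B x" if "0 \<le> x" for x using B(2)[of x] that abs_ge_zero[of "A x"] by (simp add: abs_of_nonneg)
  then have "positive B" using simple_ops_linear[OF B(1)] by (simp add: positive_def)
  then have "B \<bar>x\<bar> \<le> B (t *\<^sub>R y)" using le by (rule positive_mono)
  then show ?thesis using y by (simp add: B(2) linear_scale[OF simple_ops_linear[OF B(1)]] abs_of_nonneg)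
qed

lemma simple_ops_commute:
  assumes S: "linear S" and SP: "\<And>P x. P \<in> \<A> \<Longrightarrow> S (P x) = P (S x)"
  shows "A \<in> simple_ops \<A> \<Longrightarrow> S (A x) = A (S x)"
proof (induction rule: simple_ops.induct)
  case (const c)
  show ?case by (rule linear_scale[OF S])
next
  case (split P A B)
  then show ?case by (simp add: linear_add[OF S] linear_diff[OF S] SP)
qed

lemma simple_ops_commute_self:
  assumes "A \<in> simple_ops \<A>" "C \<in> simple_ops \<A>"
  shows "A (C x) = C (A x)"
proof (rule simple_ops_commute[OF simple_ops_linear[OF assms(1)] _ assms(2)])
  fix P x assume P: "P \<in> \<A>"
  show "A (P x) = P (A x)"
    by (rule simple_ops_commute[OF order_projection_linear[OF \<A>[OF P]] _ assms(1), symmetric])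
      (rule order_projection_commute[OF \<A>[OF P] \<A>])
qed

lemma simple_ops_riesz: "riesz_subspace ((\<lambda>A. A u) ` simple_ops \<A>)" if "0 \<le> u"
proof (rule riesz_subspaceI)
  show "subspace ((\<lambda>A. A u) ` simple_ops \<A>)"
    unfolding subspace_def
  proof (intro conjI ballI allI)
    show "0 \<in> (\<lambda>A. A u) ` simple_ops \<A>"
      by (rule image_eqI[OF _ simple_ops.const[of 0]]) simp
  next
    fix x y assume "x \<in> (\<lambda>A. A u) ` simple_ops \<A>" "y \<in> (\<lambda>A. A u) ` simple_ops \<A>"
    then obtain A B where AB: "A \<in> simple_ops \<A>" "x = A u" "B \<in> simple_ops \<A>" "y = B u" by blast
    show "x + y \<in> (\<lambda>A. A u) ` simple_ops \<A>"
      by (rule image_eqI[OF _ simple_ops_add[OF AB(1,3)]]) (simp add: AB)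
  next
    fix c x assume "x \<in> (\<lambda>A. A u) ` simple_ops \<A>"
    then obtain A where A: "A \<in> simple_ops \<A>" "x = A u" by blast
    show "c *\<^sub>R x \<in> (\<lambda>A. A u) ` simple_ops \<A>"
      by (rule image_eqI[OF _ simple_ops_scale[OF A(1), of c]]) (simp add: A)
  qed
  fix x assume "x \<in> (\<lambda>A. A u) ` simple_ops \<A>"
  then obtain A where A: "A \<in> simple_ops \<A>" "x = A u" by blast
  then obtain B where "B \<in> simple_ops \<A>" "\<bar>x\<bar> = B \<bar>u\<bar>" using simple_ops_abs by blast
  then show "\<bar>x\<bar> \<in> (\<lambda>A. A u) ` simple_ops \<A>" using that by (auto simp: abs_of_nonneg)
qed

text \<open>\<open>A - S\<close> behaves like multiplication by one fixed element, so a larger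
  argument gives a larger absolute value. This transfers an approximation of \<open>S e\<close> to
  every \<open>h\<close> with \<open>\<bar>h\<bar> \<le> e\<close>.\<close>

lemma simple_ops_diff_le:
  assumes S: "order_projection S" and h: "\<bar>h\<bar> \<le> \<bar>u\<bar>"
  shows "A \<in> simple_ops \<A> \<Longrightarrow> \<bar>A h - S h\<bar> \<le> \<bar>A u - S u\<bar>"
proof (induction rule: simple_ops.induct)
  case (const c)
  \<comment> \<open>On the band of \<open>S\<close> the operator is multiplication by
    \<open>c - 1\<close>, off it by \<open>c\<close>.\<close>
  have eq: "c *\<^sub>R x - S x = S ((c - 1) *\<^sub>R x) + (c *\<^sub>R x - S (c *\<^sub>R x))" for x
    by (simp add: order_projection_scale[OF S] order_projection_diff[OF S] algebra_simps)
  show ?case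
    unfolding eq
    by (intro order_projection_split_mono[OF S]) (simp_all only: abs_scaleR scaleR_left_mono[OF h] abs_ge_zero)
next
  case (split P A B)
  note P = \<A>[OF split.hyps(1)]
  have eq: "P (A x) + (B x - P (B x)) - S x = P (A x - S x) + ((B x - S x) - P (B x - S x))" for x
    by (simp add: order_projection_diff[OF P])
  show ?case unfolding eq by (rule order_projection_split_mono[OF P split.IH])
qed

end

context cond_exp_space begin

section \<open>Extending tests to a generated subspace\<close>

lemma simple_closure:
  assumes \<A>: "\<And>P. P \<in> \<A> \<Longrightarrow> order_projection P"
  shows "closed_riesz (T_closure ((\<lambda>A. A e) ` simple_ops \<A>))"
  by (rule T_closure_closed_riesz[OF simple_ops_riesz[OF \<A> e_nonneg]])

lemma simple_closure_superset:
  assumes \<A>: "\<And>P. P \<in> \<A> \<Longrightarrow> order_projection P" and F: "admissible F" and "projections F \<subseteq> \<A>"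
  shows "F \<subseteq> T_closure ((\<lambda>A. A e) ` simple_ops \<A>)"
proof (rule components_generate[OF F])
  show "subspace (T_closure ((\<lambda>A. A e) ` simple_ops \<A>))" "order_closed (T_closure ((\<lambda>A. A e) ` simple_ops \<A>))"
    using simple_closure[OF \<A>] by (auto simp: closed_riesz_def riesz_subspace_def)
  fix P assume "P \<in> projections F"
  then have "P \<in> simple_ops \<A>" using assms(3) simple_ops_projection[OF \<A>] by blast
  then show "P e \<in> T_closure ((\<lambda>A. A e) ` simple_ops \<A>)"
    by (intro subsetD[OF T_closure_superset] image_eqI[OF refl])
qed

text \<open>The monotone class step. \<open>T (A h)\<close> vanishes for every simple
  \<open>A\<close>, so \<open>simple_ops_diff_le\<close> bounds \<open>\<bar>T (S h)\<bar>\<close>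
  by \<open>T \<bar>S e - A e\<bar>\<close>; as \<open>S e\<close> is in the closure, such a lower
  bound of distances is at most zero.\<close>

lemma T_zero_extend:
  assumes \<A>: "\<And>P. P \<in> \<A> \<Longrightarrow> order_projection P"
    and id: "(\<lambda>x. x) \<in> \<A>" and comp: "\<And>P Q. P \<in> \<A> \<Longrightarrow> Q \<in> \<A> \<Longrightarrow> (\<lambda>x. P (Q x)) \<in> \<A>"
    and h: "\<bar>h\<bar> \<le> e" and zero: "\<And>P. P \<in> \<A> \<Longrightarrow> T (P h) = 0"
    and S: "order_projection S" "S e \<in> T_closure ((\<lambda>A. A e) ` simple_ops \<A>)"
  shows "T (S h) = 0"
proof -
  \<comment> \<open>The extra \<open>Q\<close> carries the induction: entering a branch of the tree
    composes \<open>Q\<close> with the projection at the node.\<close>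
  have zeroA: "\<forall>Q\<in>\<A>. T (Q (A h)) = 0" if "A \<in> simple_ops \<A>" for A
    using that
  proof (induction rule: simple_ops.induct)
    case (const c)
    show ?case by (simp add: order_projection_scale[OF \<A>] T_scale zero)
  next
    case (split P A B)
    show ?case
    proof
      fix Q assume Q: "Q \<in> \<A>"
      have "T (Q (P (A h))) = 0" "T (Q (P (B h))) = 0" "T (Q (B h)) = 0"
        using bspec[OF split.IH(1) comp[OF Q split.hyps(1)]] bspec[OF split.IH(2) comp[OF Q split.hyps(1)]]
          bspec[OF split.IH(2) Q] by simp_all
      then show "T (Q (P (A h) + (B h - P (B h)))) = 0"
        by (simp add: order_projection_add[OF \<A>[OF Q]] order_projection_diff[OF \<A>[OF Q]] T_add T_diff)
    qed
  qed
  have "\<bar>T (S h)\<bar> \<le> 0"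
  proof (rule T_closureD[OF S(2)])
    fix y assume "y \<in> (\<lambda>A. A e) ` simple_ops \<A>"
    then obtain A where A: "A \<in> simple_ops \<A>" "y = A e" by blast
    have "T (A h) = 0" using bspec[OF zeroA[OF A(1)] id] by simp
    then have "\<bar>T (S h)\<bar> = \<bar>T (S h - A h)\<bar>" by (simp add: T_diff)
    also have "\<dots> \<le> T \<bar>S h - A h\<bar>" by (rule positive_abs_le[OF T_positive])
    also have "\<bar>S h - A h\<bar> = \<bar>A h - S h\<bar>" by (rule abs_minus_commute)
    also have "T \<bar>A h - S h\<bar> \<le> T \<bar>A e - S e\<bar>"
      using h e_nonneg by (intro T_mono simple_ops_diff_le[OF \<A> S(1) _ A(1)]) (simp_all add: abs_of_nonneg)
    also have "\<dots> = T \<bar>S e - y\<bar>" by (simp add: A(2) abs_minus_commute)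
    finally show "\<bar>T (S h)\<bar> \<le> T \<bar>S e - y\<bar>" .
  qed
  then show ?thesis by simp
qed

end

lemma order_closed_equalizer:
  fixes S R :: "'a::riesz_space \<Rightarrow> 'b::riesz_space"
  assumes "order_continuous S" "order_continuous R"
  shows "order_closed {x. S x = R x}"
  unfolding order_closed_def
proof (intro allI impI)
  fix F :: "'a filter" and l
  assume F: "F \<noteq> bot" and ev: "eventually (\<lambda>x. x \<in> {x. S x = R x}) F" and c: "order_conv (\<lambda>x. x) l F"
  obtain D where D: "decreases_to_zero D" "\<And>d. d \<in> D \<Longrightarrow> eventually (\<lambda>x. \<bar>S x - S l\<bar> \<le> d) F"
    using assms(1) c unfolding order_continuous_def order_conv_def by meson
  obtain D' where D': "decreases_to_zero D'" "\<And>d. d \<in> D' \<Longrightarrow> eventually (\<lambda>x. \<bar>R x - R l\<bar> \<le> d) F"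
    using assms(2) c unfolding order_continuous_def order_conv_def by meson
  have "\<bar>S l - R l\<bar> \<le> 0"
  proof (rule decreases_to_zero_le[OF D(1)])
    fix d assume d: "d \<in> D"
    have "\<bar>S l - R l\<bar> - d \<le> 0"
    proof (rule decreases_to_zero_le[OF D'(1)])
      fix d' assume d': "d' \<in> D'"
      have "eventually (\<lambda>x. \<bar>S l - R l\<bar> - d \<le> d') F"
        using ev D(2)[OF d] D'(2)[OF d']
      proof eventually_elim
        case (elim x)
        have "\<bar>S l - R l\<bar> \<le> \<bar>S l - S x\<bar> + \<bar>R x - R l\<bar>"
          using abs_triangle_ineq[of "S l - S x" "R x - R l"] elim(1) by simp
        also have "\<dots> \<le> d + d'" using elim(2,3) by (intro add_mono) (simp_all add: abs_minus_commute)
        finally show ?case by (simp add: algebra_simps)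
      qed
      then show "\<bar>S l - R l\<bar> - d \<le> d'" using F eventually_happens by fastforce
    qed
    then show "\<bar>S l - R l\<bar> \<le> d" by simp
  qed
  then show "l \<in> {x. S x = R x}" by simp
qed

context cond_exp_space begin

text \<open>Both sides are the product of the two conditional expectations in the \<open>f\<close>-algebra
  structure of the principal ideal of \<open>e\<close>, which is commutative; simple operators
  replace that product.\<close>

lemma cexp_symmetric:
  assumes H: "admissible H" and P: "order_projection P" and Q: "order_projection Q"
  shows "cexp H (P (cexp H (Q e))) = cexp H (Q (cexp H (P e)))"
proof -
  let ?E = "cexp H" and ?\<A> = "simple_ops (projections H)"
  note E = cexp_linear[OF H]
  have ops_linear: "linear A" if "A \<in> ?\<A>" for A
    using that by (rule simple_ops_linear[rotated]) (rule projectionsD)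
  have ops_le: "\<bar>A x\<bar> \<le> t *\<^sub>R \<bar>A e\<bar>" if "A \<in> ?\<A>" "\<bar>x\<bar> \<le> t *\<^sub>R e" for A x t
    by (rule simple_ops_abs_le[OF _ that e_nonneg]) (rule projectionsD)
  have ops_commute: "A (C x) = C (A x)" if "A \<in> ?\<A>" "C \<in> ?\<A>" for A C x
    by (rule simple_ops_commute_self[OF _ that]) (rule projectionsD)
  have approx: "\<exists>A\<in>?\<A>. \<bar>y - A e\<bar> \<le> (1/2) ^ n *\<^sub>R e" if "y \<in> H" "0 \<le> y" "y \<le> e" for y n
  proof -
    have "\<exists>x\<in>(\<lambda>A. A e) ` ?\<A>. \<bar>y - x\<bar> \<le> (1/2) ^ n *\<^sub>R e"
    proof (rule dyadic_approximation[OF H _ _ that])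
      show "subspace ((\<lambda>A. A e) ` ?\<A>)"
        by (rule riesz_subspace_subspace[OF simple_ops_riesz[OF _ e_nonneg]]) (rule projectionsD)
      show "P e \<in> (\<lambda>A. A e) ` ?\<A>" if "P \<in> projections H" for P
        using that by (intro image_eqI[OF refl] simple_ops_projection[of "projections H"] projectionsD)
    qed
    then show ?thesis by blast
  qed
  \<comment> \<open>\<open>A (C e)\<close> stands for the product of \<open>y\<close> and
    \<open>cexp H (P e)\<close>. Replacing \<open>y\<close> by \<open>A e\<close> costs one dyadic
    unit, replacing \<open>cexp H (P e)\<close> by \<open>C e\<close> costs two, because
    \<open>\<bar>A e\<bar>\<close> is at most \<open>2 e\<close>.\<close>
  have half: "\<bar>?E (P y) - A (C e)\<bar> \<le> 3 *\<^sub>R (1/2) ^ n *\<^sub>R e"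
    if P: "order_projection P" and A: "A \<in> ?\<A>" "\<bar>y - A e\<bar> \<le> (1/2) ^ n *\<^sub>R e"
      and C: "C \<in> ?\<A>" "\<bar>?E (P e) - C e\<bar> \<le> (1/2) ^ n *\<^sub>R e" and y: "\<bar>y\<bar> \<le> e"
    for P A C y n
  proof -
    let ?\<delta> = "(1/2) ^ n :: real" and ?z = "?E (P e)"
    have lin: "linear (\<lambda>x. ?E (P x))"
      using linear_compose[OF order_projection_linear[OF P] E] by (simp add: o_def)
    have "?E (P (A e)) = A ?z"
    proof (rule simple_ops_commute[OF _ lin _ A(1)])
      show "order_projection R" if "R \<in> projections H" for R using that by (rule projectionsD)
      fix R x assume R: "R \<in> projections H"
      show "?E (P (R x)) = R (?E (P x))"
        by (simp add: order_projection_commute[OF P projectionsD[OF R]] cexp_average[OF H R])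
    qed
    then have "\<bar>?E (P y) - A ?z\<bar> = \<bar>?E (P (y - A e))\<bar>"
      by (simp add: order_projection_diff[OF P] linear_diff[OF E])
    also have "\<dots> \<le> ?\<delta> *\<^sub>R e"
      using order_projection_abs_le[OF P] A(2) order_trans by (intro cexp_abs_le[OF H]) blast
    finally have 1: "\<bar>?E (P y) - A ?z\<bar> \<le> ?\<delta> *\<^sub>R e" .
    have "A ?z - A (C e) = A (?z - C e)"
      by (simp add: linear_diff[OF ops_linear[OF A(1)]])
    then have "\<bar>A ?z - A (C e)\<bar> \<le> ?\<delta> *\<^sub>R \<bar>A e\<bar>"
      using ops_le[OF A(1) C(2)] by simp
    also have "\<dots> \<le> ?\<delta> *\<^sub>R (2 *\<^sub>R e)"
    proof (rule scaleR_left_mono)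
      have "\<bar>A e\<bar> \<le> \<bar>y\<bar> + \<bar>y - A e\<bar>" using abs_triangle_ineq[of y "A e - y"] by (simp add: abs_minus_commute)
      also have "\<dots> \<le> e + ?\<delta> *\<^sub>R e" by (rule add_mono[OF y A(2)])
      also have "\<dots> \<le> e + 1 *\<^sub>R e" by (intro add_left_mono scaleR_right_mono e_nonneg) (simp add: power_le_one)
      finally show "\<bar>A e\<bar> \<le> 2 *\<^sub>R e" by (simp add: scaleR_2)
    qed simp
    finally have 2: "\<bar>A ?z - A (C e)\<bar> \<le> ?\<delta> *\<^sub>R (2 *\<^sub>R e)" .
    have "\<bar>?E (P y) - A (C e)\<bar> \<le> \<bar>?E (P y) - A ?z\<bar> + \<bar>A ?z - A (C e)\<bar>"
      using abs_triangle_ineq[of "?E (P y) - A ?z" "A ?z - A (C e)"] by simp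
    also have "\<dots> \<le> ?\<delta> *\<^sub>R e + ?\<delta> *\<^sub>R (2 *\<^sub>R e)" by (rule add_mono[OF 1 2])
    also have "\<dots> = 3 *\<^sub>R ?\<delta> *\<^sub>R e" by (simp flip: scaleR_add_left)
    finally show ?thesis .
  qed
  have int: "0 \<le> ?E (R e)" "?E (R e) \<le> e" "\<bar>?E (R e)\<bar> \<le> e" if R: "order_projection R" for R
    using cexp_interval[OF H order_projection_nonneg[OF R e_nonneg] order_projection_le[OF R e_nonneg]]
    by (simp_all add: abs_of_nonneg)
  let ?y = "?E (Q e)" and ?z = "?E (P e)"
  \<comment> \<open>The bound \<open>6 e\<close> comes from two uses of \<open>half\<close>, each
    costing three dyadic units.\<close>
  have "?E (P ?y) - ?E (Q ?z) = 0"
  proof (rule eq_0_archimedean[of "6 *\<^sub>R e"])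
    show "0 \<le> 6 *\<^sub>R e" using e_nonneg by (simp add: scaleR_nonneg_nonneg)
    fix n
    obtain A C where A: "A \<in> ?\<A>" "\<bar>?y - A e\<bar> \<le> (1/2) ^ n *\<^sub>R e"
      and C: "C \<in> ?\<A>" "\<bar>?z - C e\<bar> \<le> (1/2) ^ n *\<^sub>R e"
      using approx[OF cexp_in[OF H] int(1,2)[OF Q]] approx[OF cexp_in[OF H] int(1,2)[OF P]] by meson
    have "\<bar>?E (P ?y) - A (C e)\<bar> \<le> 3 *\<^sub>R (1/2) ^ n *\<^sub>R e" by (rule half[OF P A C int(3)[OF Q]])
    moreover have "\<bar>?E (Q ?z) - A (C e)\<bar> \<le> 3 *\<^sub>R (1/2) ^ n *\<^sub>R e"
      using half[OF Q C A int(3)[OF P]] ops_commute[OF A(1) C(1)] by simp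
    ultimately have "\<bar>?E (P ?y) - A (C e)\<bar> + \<bar>?E (Q ?z) - A (C e)\<bar>
        \<le> 3 *\<^sub>R (1/2) ^ n *\<^sub>R e + 3 *\<^sub>R (1/2) ^ n *\<^sub>R e" by (rule add_mono)
    also have "\<dots> = (1/2) ^ n *\<^sub>R 6 *\<^sub>R e" by (simp flip: scaleR_add_left)
    finally show "\<bar>?E (P ?y) - ?E (Q ?z)\<bar> \<le> (1/2) ^ n *\<^sub>R 6 *\<^sub>R e"
      using abs_triangle_ineq4[of "?E (P ?y) - A (C e)" "?E (Q ?z) - A (C e)"]
      by (simp add: order_trans)
  qed
  then show ?thesis by simp
qed

lemma abs_diff_cexp_component_le:
  assumes H: "admissible H" and Q: "order_projection Q"
  shows "\<bar>Q e - cexp H (Q e)\<bar> \<le> e"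
proof (rule abs_leI)
  note i = order_projection_nonneg[OF Q e_nonneg] order_projection_le[OF Q e_nonneg]
  note j = cexp_interval[OF H i]
  show "Q e - cexp H (Q e) \<le> e" using i(2) j(1) by (simp add: diff_le_eq add_increasing2)
  show "- (Q e - cexp H (Q e)) \<le> e" using i(1) j(2) by (simp add: diff_le_eq add_increasing2)
qed

subsection \<open>Conditional independence\<close>

text \<open>Products of a projection from \<open>H\<close> and one from \<open>F\<close> play the
  role of measurable rectangles: they generate \<open>K\<close> and, as projections commute, are
  closed under composition. On a rectangle the test of \<open>Q e - cexp H (Q e)\<close> vanishes,
  since averaging pulls the factor from \<open>H\<close> out of \<open>cexp H\<close> and leaves the
  assumption \<open>eq\<close>.\<close>

lemma cond_indep_imp_cexp_eq:
  assumes F: "admissible F" and H: "admissible H" and K: "admissible K" and HK: "H \<subseteq> K"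
    and gen: "\<And>L. closed_riesz L \<Longrightarrow> F \<subseteq> L \<Longrightarrow> H \<subseteq> L \<Longrightarrow> K \<subseteq> L"
    and Q: "order_projection Q"
    and eq: "\<And>P. P \<in> projections F \<Longrightarrow> cexp H (P (cexp H (Q e))) = cexp H (P (Q e))"
  shows "cexp K (Q e) = cexp H (Q e)"
proof -
  define \<A> where "\<A> = {\<lambda>x. R (P x) |R P. R \<in> projections H \<and> P \<in> projections F}"
  define h where "h = Q e - cexp H (Q e)"
  have \<A>I: "(\<lambda>x. R (P x)) \<in> \<A>" if "R \<in> projections H" "P \<in> projections F" for R P
    using that unfolding \<A>_def by blast
  have \<A>: "order_projection P" if "P \<in> \<A>" for P
    using that unfolding \<A>_def by (auto intro: order_projection_compose projectionsD)
  have HA: "projections H \<subseteq> \<A>" using \<A>I[OF _ projections_id[OF F]] by auto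
  have FA: "projections F \<subseteq> \<A>" using \<A>I[OF projections_id[OF H]] by auto
  have KA: "K \<subseteq> T_closure ((\<lambda>A. A e) ` simple_ops \<A>)"
    by (intro gen simple_closure simple_closure_superset \<A> F H HA FA)
  have T0: "T (S h) = 0" if S: "S \<in> projections K" for S
  proof (rule T_zero_extend[OF \<A>, where h = h and S = S])
    show "(\<lambda>x. x) \<in> \<A>" using HA projections_id[OF H] by blast
    show "(\<lambda>x. P (P' x)) \<in> \<A>" if PP: "P \<in> \<A>" "P' \<in> \<A>" for P P'
    proof -
      obtain R1 P1 R2 P2 where *: "P = (\<lambda>x. R1 (P1 x))" "P' = (\<lambda>x. R2 (P2 x))"
        "R1 \<in> projections H" "R2 \<in> projections H" "P1 \<in> projections F" "P2 \<in> projections F"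
        using PP unfolding \<A>_def by blast
      have "(\<lambda>x. P (P' x)) = (\<lambda>x. R1 (R2 (P1 (P2 x))))"
        by (simp add: *(1,2) order_projection_commute[OF projectionsD[OF *(5)] projectionsD[OF *(4)]])
      then show ?thesis
        using \<A>I[OF projections_compose[OF H *(3,4)] projections_compose[OF F *(5,6)]] by simp
    qed
    show "\<bar>h\<bar> \<le> e" unfolding h_def by (rule abs_diff_cexp_component_le[OF H Q])
    show "T (P h) = 0" if "P \<in> \<A>" for P
    proof -
      obtain R P1 where *: "P = (\<lambda>x. R (P1 x))" "R \<in> projections H" "P1 \<in> projections F"
        using \<open>P \<in> \<A>\<close> unfolding \<A>_def by blast
      have "cexp H (P1 h) = 0"
        using eq[OF *(3)] by (simp add: h_def order_projection_diff[OF projectionsD[OF *(3)]] linear_diff[OF cexp_linear[OF H]])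
      then have "cexp H (P h) = 0"
        by (simp add: *(1) cexp_average[OF H *(2)] order_projection_0[OF projectionsD[OF *(2)]])
      then show ?thesis using cexp_T[OF H, of "P h"] by (simp add: T_0)
    qed
    show "order_projection S" using S by (rule projectionsD)
    show "S e \<in> T_closure ((\<lambda>A. A e) ` simple_ops \<A>)" using KA S by (auto simp: projections_def)
  qed
  show ?thesis
  proof (rule cexp_eqI[OF K])
    show "cexp H (Q e) \<in> K" using cexp_in[OF H] HK by blast
    fix S assume S: "S \<in> projections K"
    show "T (S (cexp H (Q e))) = T (S (Q e))"
      using T0[OF S] by (simp add: h_def order_projection_diff[OF projectionsD[OF S]] T_diff)
  qed
qed

text \<open>By the tower property \<open>cexp K\<close> may be inserted; \<open>P\<close> is then
  pulled out of it, and \<open>cexp K (Q e)\<close> can be replaced.\<close>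

lemma cexp_eq_imp_cond_indep:
  assumes H: "admissible H" and K: "admissible K" and "H \<subseteq> K"
    and P: "P \<in> projections K" and eq: "cexp K (Q e) = cexp H (Q e)"
  shows "cexp H (P (cexp H (Q e))) = cexp H (P (Q e))"
proof -
  have "cexp H (P (Q e)) = cexp H (cexp K (P (Q e)))" by (rule cexp_tower[OF H K \<open>H \<subseteq> K\<close>, symmetric])
  then show ?thesis by (simp add: cexp_average[OF K P] eq)
qed

end

section \<open>Markov processes\<close>

locale process = cond_exp_space T e
  for T :: "'a::dedekind_complete_riesz_space \<Rightarrow> 'a" and e +
  fixes X :: "'i::linorder \<Rightarrow> 'a"
begin

abbreviation S where "S \<equiv> process_space T X"
abbreviation E where "E \<equiv> process_exp T X"

lemma S_admissible: "admissible (S I)"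
  unfolding admissible_def process_space_def
  by (intro conjI closed_riesz_hull order_trans[OF Un_upper1 closed_riesz_span_superset])

lemma S_least: "closed_riesz L \<Longrightarrow> range T \<subseteq> L \<Longrightarrow> X ` I \<subseteq> L \<Longrightarrow> S I \<subseteq> L"
  unfolding process_space_def by (rule closed_riesz_span_minimal) auto

lemma X_in_S: "i \<in> I \<Longrightarrow> X i \<in> S I"
  unfolding process_space_def by (rule subsetD[OF closed_riesz_span_superset]) simp

lemma S_mono: "I \<subseteq> J \<Longrightarrow> S I \<subseteq> S J"
  using X_in_S admissible_T[OF S_admissible]
  by (intro S_least admissible_closed_riesz[OF S_admissible]) auto

lemma S_union_least: "closed_riesz L \<Longrightarrow> S I \<subseteq> L \<Longrightarrow> S J \<subseteq> L \<Longrightarrow> S (I \<union> J) \<subseteq> L"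
  using X_in_S admissible_T[OF S_admissible] by (intro S_least) blast+

lemma E_eq: "E I = cexp (S I)"
  unfolding process_exp_def by (rule cond_exp_onto_eq[OF S_admissible])

lemmas E_fixed = cexp_fixed[OF S_admissible, folded E_eq]
  and E_tower = cexp_tower[OF S_admissible S_admissible, folded E_eq]
  and E_symmetric = cexp_symmetric[OF S_admissible, folded E_eq]
  and E_in = cexp_in[OF S_admissible, folded E_eq]

text \<open>\<open>S (I \<union> J)\<close> is the least closed Riesz subspace containing
  \<open>S I\<close> and \<open>S J\<close>, so it takes the place of \<open>K\<close> in the two
  preceding criteria.\<close>

lemma cond_indep_iff:
  assumes Q: "order_projection Q"
  shows "E (I \<union> J) (Q e) = E J (Q e) \<longleftrightarrow>
    (\<forall>P\<in>projections (S I). E J (P (E J (Q e))) = E J (P (Q e)))"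
proof
  assume "E (I \<union> J) (Q e) = E J (Q e)"
  moreover have "projections (S I) \<subseteq> projections (S (I \<union> J))" by (intro projections_mono S_mono) blast
  ultimately show "\<forall>P\<in>projections (S I). E J (P (E J (Q e))) = E J (P (Q e))"
    unfolding E_eq
    by (intro ballI cexp_eq_imp_cond_indep[OF S_admissible[of J] S_admissible[of "I \<union> J"] S_mono]) auto
next
  assume "\<forall>P\<in>projections (S I). E J (P (E J (Q e))) = E J (P (Q e))"
  then show "E (I \<union> J) (Q e) = E J (Q e)"
    unfolding E_eq
    by (intro cond_indep_imp_cexp_eq[OF S_admissible[of I] S_admissible S_admissible S_mono S_union_least Q]) auto
qed

section \<open>The Markov property, the whole past, and the past-future form\<close>

lemma markov_iff:
  "markov_process T e X \<longleftrightarrow>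
    (\<forall>ts t. ts \<noteq> [] \<longrightarrow> sorted_wrt (<) (ts @ [t]) \<longrightarrow>
      (\<forall>Q\<in>projections (S {t}). E (set ts) (Q e) = E {last ts} (Q e)))"
  unfolding markov_process_def projections_def band_projection_iff by blast

lemma sorted_last_upper: "sorted_wrt (<) ts \<Longrightarrow> x \<in> set ts \<Longrightarrow> x \<le> last ts" for ts :: "'i list"
  by (induction ts rule: rev_induct) (auto simp: sorted_wrt_append intro: less_imp_le)

lemma markov_imp_past:
  assumes M: "markov_process T e X" and "u < v"
  shows "E {..u} \<circ> E {v} = E {u} \<circ> E {v}"
proof -
  \<comment> \<open>\<open>u\<close> is the largest element of \<open>I\<close>, so listing
    \<open>I\<close> in increasing order gives the situation of the Markov property with last time
    \<open>u\<close>.\<close>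
  have fin: "E I (Q e) = E {u} (Q e)"
    if I: "finite I" "u \<in> I" "I \<subseteq> {..u}" and Q: "Q \<in> projections (S {v})" for I Q
  proof -
    let ?ts = "sorted_list_of_set I"
    have ts: "?ts \<noteq> []" "set ?ts = I" using I by auto
    have "sorted_wrt (<) ?ts" by (rule strict_sorted_list_of_set)
    moreover have "\<forall>x\<in>I. x < v" using I(3) \<open>u < v\<close> by (meson atMost_iff le_less_trans subsetD)
    ultimately have "sorted_wrt (<) (?ts @ [v])" using ts by (simp add: sorted_wrt_append)
    moreover have "last ?ts = u"
      using sorted_last_upper[OF \<open>sorted_wrt (<) ?ts\<close>, of u] last_in_set[OF ts(1)] I ts(2)
      by (intro antisym) auto
    ultimately show ?thesis using M Q ts unfolding markov_iff by metis
  qed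
  \<comment> \<open>Requiring \<open>u\<close> in every \<open>I\<close> keeps it the maximum. Such
    sets are stable under union, so projections belonging to \<open>I\<close> and \<open>J\<close>
    compose to one belonging to \<open>I \<union> J\<close>.\<close>
  define \<A> where "\<A> = \<Union>{projections (S I) |I. finite I \<and> u \<in> I \<and> I \<subseteq> {..u}}"
  have \<A>I: "projections (S I) \<subseteq> \<A>" if "finite I" "u \<in> I" "I \<subseteq> {..u}" for I
    using that unfolding \<A>_def by blast
  have \<A>: "order_projection P" if "P \<in> \<A>" for P
    using that projectionsD unfolding \<A>_def by blast
  let ?L = "T_closure ((\<lambda>A. A e) ` simple_ops \<A>)"
  have sup: "S I \<subseteq> ?L" if "finite I" "u \<in> I" "I \<subseteq> {..u}" for I
    by (rule simple_closure_superset[OF \<A> S_admissible \<A>I[OF that]])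
  have past: "S {..u} \<subseteq> ?L"
  proof (rule S_least[OF simple_closure[OF \<A>]])
    show "range T \<subseteq> ?L" using sup[of "{u}"] admissible_T[OF S_admissible] by auto
    show "X ` {..u} \<subseteq> ?L"
    proof
      fix x assume "x \<in> X ` {..u}"
      then obtain n where "n \<le> u" "x = X n" by auto
      then show "x \<in> ?L" using sup[of "{u, n}"] X_in_S[of n "{u, n}"] by auto
    qed
  qed
  have comp: "E {..u} (Q e) = E {u} (Q e)" if Q: "Q \<in> projections (S {v})" for Q
  proof -
    note oQ = projectionsD[OF Q]
    define h where "h = Q e - E {u} (Q e)"
    have T0: "T (R h) = 0" if R: "R \<in> projections (S {..u})" for R
    proof (rule T_zero_extend[OF \<A>, where h = h and S = R])
      show "(\<lambda>x. x) \<in> \<A>" using \<A>I[of "{u}"] projections_id[OF S_admissible] by auto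
      show "(\<lambda>x. P (P' x)) \<in> \<A>" if PP: "P \<in> \<A>" "P' \<in> \<A>" for P P'
      proof -
        obtain I J where IJ: "finite I" "u \<in> I" "I \<subseteq> {..u}" "P \<in> projections (S I)"
          "finite J" "J \<subseteq> {..u}" "P' \<in> projections (S J)"
          using PP unfolding \<A>_def by blast
        have "P \<in> projections (S (I \<union> J))" "P' \<in> projections (S (I \<union> J))"
          using IJ(4,7) projections_mono[OF S_mono] by blast+
        then have "(\<lambda>x. P (P' x)) \<in> projections (S (I \<union> J))" by (rule projections_compose[OF S_admissible])
        then show ?thesis using \<A>I[of "I \<union> J"] IJ by blast
      qed
      show "\<bar>h\<bar> \<le> e"
        unfolding h_def E_eq by (rule abs_diff_cexp_component_le[OF S_admissible oQ])
      show "T (P h) = 0" if P: "P \<in> \<A>" for P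
      proof -
        obtain I where I: "finite I" "u \<in> I" "I \<subseteq> {..u}" "P \<in> projections (S I)"
          using P unfolding \<A>_def by blast
        have "T (P (E {u} (Q e))) = T (P (E I (Q e)))" using fin[OF I(1-3) Q] by simp
        also have "\<dots> = T (P (Q e))" unfolding E_eq by (rule T_cexp[OF S_admissible I(4)])
        finally show ?thesis by (simp add: h_def order_projection_diff[OF projectionsD[OF I(4)]] T_diff)
      qed
      show "order_projection R" using R by (rule projectionsD)
      show "R e \<in> ?L" using past R by (auto simp: projections_def)
    qed
    show ?thesis
      unfolding E_eq[of "{..u}"]
    proof (rule cexp_eqI[OF S_admissible])
      show "E {u} (Q e) \<in> S {..u}" using E_in S_mono[of "{u}" "{..u}"] by auto
      fix R assume R: "R \<in> projections (S {..u})"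
      show "T (R (E {u} (Q e))) = T (R (Q e))"
        using T0[OF R] by (simp add: h_def order_projection_diff[OF projectionsD[OF R]] T_diff)
    qed
  qed
  \<comment> \<open>The set of agreement is an order closed subspace, so equality on the components
    \<open>Q e\<close> extends to the whole range of \<open>E {v}\<close>.\<close>
  have "S {v} \<subseteq> {x. E {..u} x = E {u} x}"
  proof (rule components_generate[OF S_admissible])
    show "subspace {x. E {..u} x = E {u} x}"
      unfolding subspace_def E_eq using cexp_linear[OF S_admissible]
      by (auto simp: linear_0 linear_add linear_scale)
    show "order_closed {x. E {..u} x = E {u} x}"
      unfolding E_eq
      by (intro order_closed_equalizer conditional_expectation_continuous cexp_conditional_expectation S_admissible)
  qed (use comp in simp)
  then show ?thesis using E_in by (auto simp: fun_eq_iff)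
qed

text \<open>\<open>set ts\<close> lies between its last time and the whole past of that time.
  Conditioning on the whole past already collapses to the last time, and conditioning that result on
  \<open>set ts\<close> changes nothing.\<close>

lemma past_imp_markov:
  assumes past: "\<And>u v. u < v \<Longrightarrow> E {..u} \<circ> E {v} = E {u} \<circ> E {v}"
  shows "markov_process T e X"
  unfolding markov_iff
proof (intro allI impI ballI)
  fix ts t Q
  assume ts: "ts \<noteq> []" "sorted_wrt (<) (ts @ [t])" and Q: "Q \<in> projections (S {t})"
  let ?u = "last ts"
  have "?u < t" using ts by (simp add: sorted_wrt_append)
  have sub: "set ts \<subseteq> {..?u}" "{?u} \<subseteq> set ts"
    using sorted_last_upper[of ts] ts by (auto simp: sorted_wrt_append)
  have "Q e = E {t} (Q e)" using Q E_fixed[of "Q e" "{t}"] by (simp add: projections_def)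
  then have eq: "E {..?u} (Q e) = E {?u} (Q e)" using past[OF \<open>?u < t\<close>] by (metis comp_apply)
  have "E (set ts) (Q e) = E (set ts) (E {..?u} (Q e))" by (simp add: E_tower[OF S_mono[OF sub(1)]])
  also have "\<dots> = E (set ts) (E {?u} (Q e))" by (simp only: eq)
  also have "\<dots> = E {?u} (Q e)" using E_in S_mono[OF sub(2)] by (intro E_fixed) blast
  finally show "E (set ts) (Q e) = E {?u} (Q e)" .
qed

text \<open>The Markov property read backwards: once the present is known, the future adds nothing
  about an event of the past. This is the form in which the future can grow one time at a
  time.\<close>

lemma markov_imp_future:
  assumes M: "markov_process T e X" and "ts \<noteq> []" and P: "P \<in> projections (S (set ts))"
  shows "sorted_wrt (<) (ts @ t # ss) \<Longrightarrow> E (set ss \<union> {t}) (P e) = E {t} (P e)"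
proof (induction ss rule: rev_induct)
  case Nil
  then show ?case by simp
next
  case (snoc s ss)
  let ?H = "set ss \<union> {t}"
  note oP = projectionsD[OF P]
  have s1: "sorted_wrt (<) ((ts @ t # ss) @ [s])" and s2: "sorted_wrt (<) ((t # ss) @ [s])"
    using snoc.prems by (auto simp: sorted_wrt_append)
  have IH: "E ?H (P e) = E {t} (P e)"
    using snoc.IH snoc.prems by (auto simp: sorted_wrt_append)
  have "E ?H (Q (E ?H (P e))) = E ?H (Q (P e))" if Q: "Q \<in> projections (S {s})" for Q
  proof -
    note oQ = projectionsD[OF Q]
    \<comment> \<open>Both lists of times before \<open>s\<close> end in the same time, so the
      Markov property gives \<open>Q e\<close> the same conditional expectation with or without
      \<open>ts\<close>.\<close>
    have "E (set (ts @ t # ss)) (Q e) = E {last (ts @ t # ss)} (Q e)"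
      using M s1 Q unfolding markov_iff by blast
    also have "\<dots> = E {last (t # ss)} (Q e)" by simp
    also have "\<dots> = E (set (t # ss)) (Q e)"
      using M s2 Q unfolding markov_iff by (metis list.distinct(1))
    finally have "E (set ts \<union> ?H) (Q e) = E ?H (Q e)" by simp
    then have "E ?H (P (E ?H (Q e))) = E ?H (P (Q e))" using P cond_indep_iff[OF oQ] by blast
    \<comment> \<open>Exchanging \<open>P\<close> and \<open>Q\<close> turns independence of
      \<open>Q\<close> from the past into a statement about \<open>P e\<close>, which lets
      \<open>s\<close> join the conditioning times.\<close>
    then show ?thesis by (simp add: E_symmetric[OF oQ oP] order_projection_commute[OF oQ oP])
  qed
  then have "E ({s} \<union> ?H) (P e) = E ?H (P e)" using cond_indep_iff[OF oP] by blast
  then show ?case using IH by simp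
qed

lemma markov_iff_past_future:
  "markov_process T e X \<longleftrightarrow>
    (\<forall>ts t ss P Q. ts \<noteq> [] \<longrightarrow> ss \<noteq> [] \<longrightarrow> sorted_wrt (<) (ts @ t # ss) \<longrightarrow>
       P \<in> projections (S (set ts)) \<longrightarrow> Q \<in> projections (S (set ss)) \<longrightarrow>
       E {t} (Q (E {t} (P e))) = E {t} (Q (P e)))"
proof
  assume M: "markov_process T e X"
  show "\<forall>ts t ss P Q. ts \<noteq> [] \<longrightarrow> ss \<noteq> [] \<longrightarrow> sorted_wrt (<) (ts @ t # ss) \<longrightarrow>
       P \<in> projections (S (set ts)) \<longrightarrow> Q \<in> projections (S (set ss)) \<longrightarrow>
       E {t} (Q (E {t} (P e))) = E {t} (Q (P e))"
    using markov_imp_future[OF M] cond_indep_iff[OF projectionsD] by blast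
next
  assume *: "\<forall>ts t ss P Q. ts \<noteq> [] \<longrightarrow> ss \<noteq> [] \<longrightarrow> sorted_wrt (<) (ts @ t # ss) \<longrightarrow>
       P \<in> projections (S (set ts)) \<longrightarrow> Q \<in> projections (S (set ss)) \<longrightarrow>
       E {t} (Q (E {t} (P e))) = E {t} (Q (P e))"
  show "markov_process T e X"
    unfolding markov_iff
  proof (intro allI impI ballI)
    fix ts t Q
    assume ts: "ts \<noteq> []" "sorted_wrt (<) (ts @ [t])" and Q: "Q \<in> projections (S {t})"
    \<comment> \<open>\<open>u\<close> becomes the present and the earlier times the past; for a
      single time the claim is an identity.\<close>
    define us u where "us = butlast ts" and "u = last ts"
    have us: "ts = us @ [u]" using ts(1) by (simp add: us_def u_def)
    note oQ = projectionsD[OF Q]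
    show "E (set ts) (Q e) = E {last ts} (Q e)"
    proof (cases "us = []")
      case True
      then show ?thesis by (simp add: us)
    next
      case False
      have "E {u} (P (E {u} (Q e))) = E {u} (P (Q e))" if P: "P \<in> projections (S (set us))" for P
      proof -
        note oP = projectionsD[OF P]
        \<comment> \<open>The future consists of the one time \<open>t\<close>.\<close>
        have "E {u} (Q (E {u} (P e))) = E {u} (Q (P e))"
          using *[rule_format, of us "[t]" u P Q] False ts(2) P Q by (simp add: us)
        then show ?thesis by (simp add: E_symmetric[OF oP oQ] order_projection_commute[OF oP oQ])
      qed
      then have "E (set us \<union> {u}) (Q e) = E {u} (Q e)" using cond_indep_iff[OF oQ] by blast
      then show ?thesis by (simp add: us)
    qed
  qed
qed

text \<open>The chain in (iii) amounts to its first equation: the middle one is commutation of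
  projections, and the last follows from the first by \<open>E_symmetric\<close>.\<close>

lemma past_future_symmetric:
  assumes P: "order_projection P" and Q: "order_projection Q"
  shows "E J (Q (E J (P e))) = E J (Q (P e)) \<longleftrightarrow>
    E J (Q (E J (P e))) = E J (Q (P e)) \<and> E J (Q (P e)) = E J (P (Q e)) \<and>
    E J (P (Q e)) = E J (P (E J (Q e)))"
  using E_symmetric[OF P Q, of J] order_projection_commute[OF P Q, of e] by auto

end

theorem theorem4p6:
  fixes T :: "'a::dedekind_complete_riesz_space \<Rightarrow> 'a"
    and e :: 'a
    and X :: "'i::linorder \<Rightarrow> 'a"
  assumes "conditional_expectation T"
    and "strictly_positive T"
    and "universally_complete T"
    and "weak_order_unit e"
    and "T e = e"
  shows "(markov_process T e X \<longleftrightarrow>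
      (\<forall>u v. u < v \<longrightarrow>
         process_exp T X {..u} \<circ> process_exp T X {v} = process_exp T X {u} \<circ> process_exp T X {v})) \<and>
    (markov_process T e X \<longleftrightarrow>
      (\<forall>ts t ss P Q. ts \<noteq> [] \<longrightarrow> ss \<noteq> [] \<longrightarrow> sorted_wrt (<) (ts @ t # ss) \<longrightarrow>
         band_projection P \<longrightarrow> band_projection Q \<longrightarrow>
         Q e \<in> process_space T X (set ss) \<longrightarrow> P e \<in> process_space T X (set ts) \<longrightarrow>
         (let Tt = process_exp T X {t} in
            Tt (Q (Tt (P e))) = Tt (Q (P e)) \<and>
            Tt (Q (P e)) = Tt (P (Q e)) \<and>
            Tt (P (Q e)) = Tt (P (Tt (Q e))))))"
proof
  interpret process T e X by unfold_locales (rule assms)+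
  show "markov_process T e X \<longleftrightarrow>
      (\<forall>u v. u < v \<longrightarrow> E {..u} \<circ> E {v} = E {u} \<circ> E {v})"
    using markov_imp_past past_imp_markov by blast
  show "markov_process T e X \<longleftrightarrow>
      (\<forall>ts t ss P Q. ts \<noteq> [] \<longrightarrow> ss \<noteq> [] \<longrightarrow> sorted_wrt (<) (ts @ t # ss) \<longrightarrow>
         band_projection P \<longrightarrow> band_projection Q \<longrightarrow> Q e \<in> S (set ss) \<longrightarrow> P e \<in> S (set ts) \<longrightarrow>
         (let Tt = E {t} in
            Tt (Q (Tt (P e))) = Tt (Q (P e)) \<and> Tt (Q (P e)) = Tt (P (Q e)) \<and>
            Tt (P (Q e)) = Tt (P (Tt (Q e)))))"
    (is "_ \<longleftrightarrow> ?R")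
  proof
    assume M: "markov_process T e X"
    show ?R
      unfolding Let_def
    proof (intro allI impI)
      fix ts t ss P Q
      assume *: "ts \<noteq> []" "ss \<noteq> []" "sorted_wrt (<) (ts @ t # ss)"
        "band_projection P" "band_projection Q" "Q e \<in> S (set ss)" "P e \<in> S (set ts)"
      then have P: "order_projection P" "P \<in> projections (S (set ts))"
        and Q: "order_projection Q" "Q \<in> projections (S (set ss))"
        by (simp_all add: band_projection_iff projections_def)
      show "E {t} (Q (E {t} (P e))) = E {t} (Q (P e)) \<and> E {t} (Q (P e)) = E {t} (P (Q e)) \<and>
          E {t} (P (Q e)) = E {t} (P (E {t} (Q e)))"
        by (rule past_future_symmetric[OF P(1) Q(1), THEN iffD1])
          (rule M[unfolded markov_iff_past_future, rule_format, OF *(1-3) P(2) Q(2)])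
    qed
  next
    assume R: ?R
    show "markov_process T e X"
      unfolding markov_iff_past_future
    proof (intro allI impI)
      fix ts t ss P Q
      assume *: "ts \<noteq> []" "ss \<noteq> []" "sorted_wrt (<) (ts @ t # ss)"
        and "P \<in> projections (S (set ts))" "Q \<in> projections (S (set ss))"
      then have "band_projection P" "band_projection Q" "Q e \<in> S (set ss)" "P e \<in> S (set ts)"
        by (simp_all add: band_projection_iff projections_def)
      then show "E {t} (Q (E {t} (P e))) = E {t} (Q (P e))"
        using R * unfolding Let_def by blast
    qed
  qed
qed

end
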